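(* Suppose $\mathcal{S} \subseteq M_n$ is an operator system that has dimension 3 and contains a rank one normal matrix. Then $\mathcal{S}$ is a maximal operator system.
   Context: $M_n$ is the algebra of $n\times n$ complex matrices, identified with $\mathcal{B}(\mathbb{C}^n)$. $\mathcal{B}(\mathcal{K})$ is the algebra of bounded linear operators on a complex Hilbert space $\mathcal{K}$. Dimension means dimension as a complex vector space. An operator system in $M_n$ is a self-adjoint linear subspace containing the identity $I_n$. A linear map $\Phi:\mathcal{S}\to\mathcal{B}(\mathcal{K})$ is unital if $\Phi(I_n)=I_{\mathcal{K}}$, positive if it maps positive semidefinite elements of $\mathcal{S}$ to positive semidefinite operators, and completely positive if for every $k\ge1$ the map $M_k(\mathcal{S})\to M_k(\mathcal{B}(\mathcal{K}))$, $(S_{ij})\mapsto(\Phi(S_{ij}))$, is positive. An operator system $\mathcal{S}$ is a maximal operator system (OMAX) if, for every Hilbert space $\mathcal{K}$, every unital positive map $\Phi:\mathcal{S}\to\mathcal{B}(\mathcal{K})$ is completely positive. *)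

theory Defs
  imports "HOL-Analysis.Analysis" "HOL-Library.Complex_Order"
begin

class complex_vector = real_vector +
  fixes scaleC :: "complex \<Rightarrow> 'a \<Rightarrow> 'a" (infixr "*\<^sub>C" 75)
  assumes scaleC_add_right: "a *\<^sub>C (x + y) = a *\<^sub>C x + a *\<^sub>C y"
    and scaleC_add_left: "(a + b) *\<^sub>C x = a *\<^sub>C x + b *\<^sub>C x"
    and scaleC_scaleC: "a *\<^sub>C (b *\<^sub>C x) = (a * b) *\<^sub>C x"
    and scaleC_one: "1 *\<^sub>C x = x"
    and scaleR_scaleC: "r *\<^sub>R x = complex_of_real r *\<^sub>C x"

global_interpretation complex_vector:
  vector_space "scaleC :: complex \<Rightarrow> 'a \<Rightarrow> 'a::complex_vector"
  by standard (rule scaleC_add_right scaleC_add_left scaleC_scaleC scaleC_one)+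

text \<open>The inner product is conjugate-linear in the first and linear in the second argument;
  completeness comes from \<^class>\<open>banach\<close>.\<close>

class chilbert_space = complex_vector + banach +
  fixes cinner :: "'a \<Rightarrow> 'a \<Rightarrow> complex"
  assumes cinner_commute: "cinner x y = cnj (cinner y x)"
    and cinner_add_right: "cinner x (y + z) = cinner x y + cinner x z"
    and cinner_scaleC_right: "cinner x (c *\<^sub>C y) = c * cinner x y"
    and cinner_ge_zero: "0 \<le> cinner x x"
    and cinner_eq_zero_iff: "cinner x x = 0 \<longleftrightarrow> x = 0"
    and norm_eq_sqrt_cinner: "norm x = sqrt (Re (cinner x x))"

instantiation complex :: chilbert_space
begin

definition scaleC_complex_def: "c *\<^sub>C (z::complex) = c * z"

definition cinner_complex_def: "cinner (x::complex) y = cnj x * y"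

instance
proof
  fix x :: complex
  show "0 \<le> cinner x x"
    by (simp add: cinner_complex_def less_eq_complex_def)
  show "norm x = sqrt (Re (cinner x x))"
    by (simp add: cinner_complex_def cmod_def power2_eq_square)
qed (auto simp: scaleC_complex_def cinner_complex_def algebra_simps scaleR_conv_of_real)

end

instantiation vec :: (complex_vector, finite) complex_vector
begin

definition scaleC_vec_def: "c *\<^sub>C v = (\<chi> i. c *\<^sub>C (v $ i))"

instance
  by standard
    (auto simp: scaleC_vec_def vec_eq_iff scaleC_add_right scaleC_add_left scaleC_scaleC
      scaleC_one scaleR_scaleC)

end

instantiation vec :: (chilbert_space, finite) chilbert_space
begin

definition cinner_vec_def: "cinner v w = (\<Sum>i\<in>UNIV. cinner (v $ i) (w $ i))"

instance
proof
  fix x y z :: "'a ^ 'b" and c :: complex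
  show "cinner x y = cnj (cinner y x)"
    unfolding cinner_vec_def cnj_sum by (intro sum.cong refl cinner_commute)
  show "cinner x (y + z) = cinner x y + cinner x z"
    by (simp add: cinner_vec_def cinner_add_right sum.distrib)
  show "cinner x (c *\<^sub>C y) = c * cinner x y"
    by (simp add: cinner_vec_def scaleC_vec_def cinner_scaleC_right sum_distrib_left)
  show "0 \<le> cinner x x"
    unfolding cinner_vec_def by (intro sum_nonneg cinner_ge_zero)
  show "cinner x x = 0 \<longleftrightarrow> x = 0"
    unfolding cinner_vec_def
    by (subst sum_nonneg_eq_0_iff) (auto simp: cinner_ge_zero cinner_eq_zero_iff vec_eq_iff)
  have "(norm a)\<^sup>2 = Re (cinner a a)" for a :: 'a
    using cinner_ge_zero[of a] by (simp add: norm_eq_sqrt_cinner less_eq_complex_def)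
  then show "norm x = sqrt (Re (cinner x x))"
    by (simp add: norm_vec_def L2_set_def cinner_vec_def)
qed

end

definition bounded_operators :: "('k::chilbert_space \<Rightarrow> 'k) set" where
  "bounded_operators = {T. bounded_linear T \<and> (\<forall>c x. T (c *\<^sub>C x) = c *\<^sub>C T x)}"

definition positive_operator :: "('k::chilbert_space \<Rightarrow> 'k) \<Rightarrow> bool" where
  "positive_operator T \<longleftrightarrow> (\<forall>x. 0 \<le> cinner x (T x))"

text \<open>Positivity of the operator on the \<open>k\<close>-fold direct sum of the space that is given by the
  \<open>k \<times> k\<close> block matrix \<open>(T i j)\<close>.\<close>

definition positive_block_operator ::
    "nat \<Rightarrow> (nat \<Rightarrow> nat \<Rightarrow> 'k::chilbert_space \<Rightarrow> 'k) \<Rightarrow> bool" where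
  "positive_block_operator k T \<longleftrightarrow>
     (\<forall>x::nat \<Rightarrow> 'k. 0 \<le> (\<Sum>i<k. cinner (x i) (\<Sum>j<k. T i j (x j))))"

definition cadjoint :: "complex ^ 'n ^ 'm \<Rightarrow> complex ^ 'm ^ 'n" where
  "cadjoint A = (\<chi> i j. cnj (A $ j $ i))"

definition normal_matrix :: "complex ^ 'n ^ 'n \<Rightarrow> bool" where
  "normal_matrix A \<longleftrightarrow> A ** cadjoint A = cadjoint A ** A"

definition operator_system :: "(complex ^ 'n ^ 'n) set \<Rightarrow> bool" where
  "operator_system S \<longleftrightarrow>
     complex_vector.subspace S \<and> (\<forall>A\<in>S. cadjoint A \<in> S) \<and> mat 1 \<in> S"

text \<open>In the following, a map defined on \<open>S\<close> is represented by a function on all matrices,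
  only whose values on \<open>S\<close> matter.\<close>

definition operator_linear_map ::
    "(complex ^ 'n ^ 'n) set \<Rightarrow> (complex ^ 'n ^ 'n \<Rightarrow> 'k::chilbert_space \<Rightarrow> 'k) \<Rightarrow> bool" where
  "operator_linear_map S \<Phi> \<longleftrightarrow>
     (\<forall>A\<in>S. \<Phi> A \<in> bounded_operators) \<and>
     (\<forall>A\<in>S. \<forall>B\<in>S. \<forall>x. \<Phi> (A + B) x = \<Phi> A x + \<Phi> B x) \<and>
     (\<forall>c. \<forall>A\<in>S. \<forall>x. \<Phi> (c *\<^sub>C A) x = c *\<^sub>C \<Phi> A x)"

definition unital_map :: "(complex ^ 'n ^ 'n \<Rightarrow> 'k::chilbert_space \<Rightarrow> 'k) \<Rightarrow> bool" where
  "unital_map \<Phi> \<longleftrightarrow> \<Phi> (mat 1) = id"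

definition positive_map ::
    "(complex ^ 'n ^ 'n) set \<Rightarrow> (complex ^ 'n ^ 'n \<Rightarrow> 'k::chilbert_space \<Rightarrow> 'k) \<Rightarrow> bool" where
  "positive_map S \<Phi> \<longleftrightarrow>
     (\<forall>A\<in>S. positive_operator ((*v) A) \<longrightarrow> positive_operator (\<Phi> A))"

definition completely_positive_map ::
    "(complex ^ 'n ^ 'n) set \<Rightarrow> (complex ^ 'n ^ 'n \<Rightarrow> 'k::chilbert_space \<Rightarrow> 'k) \<Rightarrow> bool" where
  "completely_positive_map S \<Phi> \<longleftrightarrow>
     (\<forall>k\<ge>1. \<forall>A :: nat \<Rightarrow> nat \<Rightarrow> complex ^ 'n ^ 'n.
        (\<forall>i<k. \<forall>j<k. A i j \<in> S) \<longrightarrow>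
        positive_block_operator k (\<lambda>i j. (*v) (A i j)) \<longrightarrow>
        positive_block_operator k (\<lambda>i j. \<Phi> (A i j)))"

text \<open>A definition in HOL cannot quantify over all Hilbert spaces, so the space is a type argument;
  being a maximal operator system means that the predicate holds for \<open>TYPE('k)\<close> with an arbitrary
  type variable \<open>'k\<close>.\<close>

definition maximal_operator_system ::
    "'k::chilbert_space itself \<Rightarrow> (complex ^ 'n ^ 'n) set \<Rightarrow> bool" where
  "maximal_operator_system _ S \<longleftrightarrow>
     operator_system S \<and>
     (\<forall>\<Phi> :: complex ^ 'n ^ 'n \<Rightarrow> 'k \<Rightarrow> 'k.
        operator_linear_map S \<Phi> \<longrightarrow> unital_map \<Phi> \<longrightarrow> positive_map S \<Phi> \<longrightarrow>
        completely_positive_map S \<Phi>)"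

end

theory Submission
  imports Defs
begin

text \<open>
  A rank one normal matrix is a nonzero multiple of \<open>P = v v\<^sup>*\<close> for a vector \<open>v\<close>. Since the
  dimension is three, \<open>S\<close> is spanned by \<open>I\<close>, \<open>P\<close> and one more matrix \<open>A\<close>, which can be taken
  self-adjoint, and a positive element of \<open>M\<^sub>k(S)\<close> has the form
  \<open>T = X \<otimes> I + Y \<otimes> P + Z \<otimes> A\<close> with Hermitian \<open>k \<times> k\<close> matrices \<open>X\<close>, \<open>Y\<close>, \<open>Z\<close>. The
  theorem holds because such a \<open>T\<close> is, up to an arbitrarily small perturbation, a sum of terms
  \<open>M \<otimes> s\<close> with \<open>M\<close> and \<open>s \<in> S\<close> positive, and a positive map preserves the positivity of
  each of these terms.

  The decomposition rests on the following observation. Compressing \<open>T\<close> to a unit vector \<open>e\<close>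
  orthogonal to \<open>v\<close> removes \<open>Y\<close> and shows that \<open>X + d Z\<close> is positive semidefinite, where
  \<open>d = \<langle>e, A e\<rangle>\<close>. After adding \<open>\<epsilon> I\<close> to \<open>T\<close> it is positive definite, so
  \<open>X + d Z\<close> and \<open>Z\<close>, and hence \<open>X\<close> and \<open>Z\<close>, become diagonal under one congruence
  (\<open>simultaneous_diagonalisation\<close>). In the new coordinates
  \<open>T = diag(B\<^sub>1, \<dots>, B\<^sub>k) + Y \<otimes> P\<close> with \<open>B\<^sub>l = \<xi>\<^sub>l I + \<zeta>\<^sub>l A\<close>, where \<open>Y\<close> now
  denotes the transformed matrix, so that only \<open>Y\<close> couples the diagonal blocks.

  Let \<open>\<eta>\<^sub>l\<close> be the least number for which \<open>B\<^sub>l + \<eta>\<^sub>l P\<close> is positive, that is,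
  \<open>- \<eta>\<^sub>l\<close> is the infimum of \<open>\<langle>w, B\<^sub>l w\<rangle>\<close> over all \<open>w\<close> with \<open>\<langle>v, w\<rangle> = 1\<close>. Testing
  \<open>T\<close> on the vectors \<open>(c\<^sub>1 w\<^sub>1, \<dots>, c\<^sub>k w\<^sub>k)\<close> with nearly optimal \<open>w\<^sub>l\<close> shows that
  \<open>Y - diag(\<eta>\<^sub>1, \<dots>, \<eta>\<^sub>k)\<close> is positive semidefinite; here it matters that \<open>P\<close> has rank one,
  because \<open>P\<close> then sees only the scalars \<open>c\<^sub>l\<close>. Consequently
  \<open>T = diag(B\<^sub>l + \<eta>\<^sub>l P) + (Y - diag(\<eta>\<^sub>l)) \<otimes> P\<close> is a sum of the required kind
  (\<open>positivity_transfer_diagonal\<close>).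

  Matrices and operators enter through their sesquilinear forms: the decomposition is made for
  \<open>\<langle>u, w\<rangle>\<close>, \<open>\<langle>u, P w\<rangle>\<close>, \<open>\<langle>u, A w\<rangle>\<close>, and it is evaluated on
  \<open>\<langle>x, y\<rangle>\<close>, \<open>\<langle>x, \<Phi>(P) y\<rangle>\<close>, \<open>\<langle>x, \<Phi>(A) y\<rangle>\<close>, because a congruence
  of the scalar factors acts in the same way on both sides.
\<close>

section \<open>Sesquilinear forms and block forms\<close>

definition sesquilinear :: "('a::complex_vector \<Rightarrow> 'a \<Rightarrow> complex) \<Rightarrow> bool" where
  "sesquilinear f \<longleftrightarrow>
     (\<forall>x y z. f (x + y) z = f x z + f y z \<and> f z (x + y) = f z x + f z y) \<and>
     (\<forall>c x y. f (c *\<^sub>C x) y = cnj c * f x y \<and> f x (c *\<^sub>C y) = c * f x y)"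

lemma sesquilinearD:
  assumes "sesquilinear f"
  shows "f (x + y) z = f x z + f y z" "f z (x + y) = f z x + f z y"
    "f (c *\<^sub>C x) y = cnj c * f x y" "f x (c *\<^sub>C y) = c * f x y"
  using assms by (auto simp: sesquilinear_def)

lemma sesquilinear_0:
  assumes "sesquilinear f"
  shows "f 0 y = 0" "f x 0 = 0"
  using sesquilinearD(1)[OF assms, of 0 0 y] sesquilinearD(2)[OF assms, of x 0 0] by auto

lemma sesquilinear_sum:
  assumes "sesquilinear f"
  shows "f (\<Sum>r\<in>J. u r) y = (\<Sum>r\<in>J. f (u r) y)" "f x (\<Sum>r\<in>J. u r) = (\<Sum>r\<in>J. f x (u r))"
  by (induction J rule: infinite_finite_induct;
      simp add: sesquilinear_0[OF assms] sesquilinearD[OF assms])+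

lemma cinner_add_left: "cinner (x + y) z = cinner x z + cinner y z"
  by (metis cinner_add_right cinner_commute complex_cnj_add)

lemma cinner_scaleC_left: "cinner (c *\<^sub>C x) y = cnj c * cinner x y"
  by (metis cinner_scaleC_right cinner_commute complex_cnj_mult)

lemma sesquilinear_cinner: "sesquilinear cinner"
  by (simp add: sesquilinear_def cinner_add_left cinner_add_right cinner_scaleC_left
      cinner_scaleC_right)

lemma sesquilinear_cinner_operator:
  assumes "T \<in> bounded_operators"
  shows "sesquilinear (\<lambda>x y. cinner x (T y))"
  using assms
  by (auto simp: sesquilinear_def bounded_operators_def cinner_add_left cinner_add_right
      cinner_scaleC_left cinner_scaleC_right linear_add bounded_linear.linear)

text \<open>
  The value at \<open>x\<close>, \<open>y\<close> of the form on the direct sum of copies of the space that belongs to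
  \<open>M \<otimes> f\<close>. With \<open>f\<close> the inner product of \<open>\<complex>\<close> it is the form of the scalar matrix \<open>M\<close>
  itself, so that one set of lemmas serves scalar and operator entries.
\<close>

definition block_form ::
    "'i set \<Rightarrow> ('i \<Rightarrow> 'i \<Rightarrow> complex) \<Rightarrow> ('a \<Rightarrow> 'a \<Rightarrow> complex) \<Rightarrow> ('i \<Rightarrow> 'a) \<Rightarrow> ('i \<Rightarrow> 'a) \<Rightarrow> complex"
  where "block_form I M f x y = (\<Sum>i\<in>I. \<Sum>j\<in>I. M i j * f (x i) (y j))"

abbreviation matrix_form ::
    "'i set \<Rightarrow> ('i \<Rightarrow> 'i \<Rightarrow> complex) \<Rightarrow> ('i \<Rightarrow> complex) \<Rightarrow> ('i \<Rightarrow> complex) \<Rightarrow> complex"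
  where "matrix_form I M \<equiv> block_form I M cinner"

definition hermitian_on :: "'i set \<Rightarrow> ('i \<Rightarrow> 'i \<Rightarrow> complex) \<Rightarrow> bool" where
  "hermitian_on I M \<longleftrightarrow> (\<forall>i\<in>I. \<forall>j\<in>I. M j i = cnj (M i j))"

lemma hermitian_onD: "hermitian_on I M \<Longrightarrow> i \<in> I \<Longrightarrow> j \<in> I \<Longrightarrow> M j i = cnj (M i j)"
  unfolding hermitian_on_def by blast

definition positive_definite_on :: "'i set \<Rightarrow> ('i \<Rightarrow> 'i \<Rightarrow> complex) \<Rightarrow> bool" where
  "positive_definite_on I M \<longleftrightarrow> (\<forall>c. (\<exists>i\<in>I. c i \<noteq> 0) \<longrightarrow> 0 < Re (matrix_form I M c c))"

lemma block_form_cong: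
  assumes "\<And>i. i \<in> I \<Longrightarrow> x i = x' i" "\<And>i. i \<in> I \<Longrightarrow> y i = y' i"
    and "\<And>i j. i \<in> I \<Longrightarrow> j \<in> I \<Longrightarrow> M i j = N i j"
  shows "block_form I M f x y = block_form I N f x' y'"
  unfolding block_form_def by (intro sum.cong refl) (simp add: assms)

lemma block_form_add:
  assumes "sesquilinear f"
  shows "block_form I M f (\<lambda>i. x i + y i) z = block_form I M f x z + block_form I M f y z"
    "block_form I M f z (\<lambda>i. x i + y i) = block_form I M f z x + block_form I M f z y"
  by (simp_all add: block_form_def sesquilinearD[OF assms] sum.distrib algebra_simps)

lemma block_form_scale:
  assumes "sesquilinear f"
  shows "block_form I M f (\<lambda>i. c *\<^sub>C x i) y = cnj c * block_form I M f x y"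
    "block_form I M f x (\<lambda>i. c *\<^sub>C y i) = c * block_form I M f x y"
  by (simp_all add: block_form_def sesquilinearD[OF assms] sum_distrib_left algebra_simps)

lemma block_form_lincomb:
  "block_form I (\<lambda>i j. a * M i j + b * N i j) f x y
     = a * block_form I M f x y + b * block_form I N f x y"
  by (simp add: block_form_def sum_distrib_left sum.distrib algebra_simps)

lemma matrix_form_commute:
  assumes "hermitian_on I M"
  shows "matrix_form I M y x = cnj (matrix_form I M x y)"
proof -
  have "cnj (matrix_form I M x y) = (\<Sum>i\<in>I. \<Sum>j\<in>I. cnj (M i j) * cinner (y j) (x i))"
    by (simp add: block_form_def cinner_complex_def mult.commute)
  also have "\<dots> = (\<Sum>i\<in>I. \<Sum>j\<in>I. M j i * cinner (y j) (x i))"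
    by (intro sum.cong refl) (simp add: hermitian_onD[OF assms, symmetric])
  also have "\<dots> = matrix_form I M y x"
    unfolding block_form_def by (rule sum.swap)
  finally show ?thesis by simp
qed

text \<open>
  Substituting \<open>x = E u\<close> turns \<open>M \<otimes> f\<close> into \<open>(E\<^sup>* M E) \<otimes> f\<close>: a congruence acts on the scalar
  factor alone, whatever the form \<open>f\<close> is. This lets one congruence, found for scalar matrices,
  simplify the block forms on both sides of a positive map.
\<close>

lemma block_form_change_basis:
  assumes f: "sesquilinear f"
    and x: "\<And>i. i \<in> I \<Longrightarrow> x i = (\<Sum>r\<in>J. E r i *\<^sub>C u r)"
    and y: "\<And>i. i \<in> I \<Longrightarrow> y i = (\<Sum>r\<in>J. E r i *\<^sub>C w r)"
  shows "block_form I M f x y = block_form J (\<lambda>r s. matrix_form I M (E r) (E s)) f u w"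
proof -
  have "f (x i) (y j) = (\<Sum>r\<in>J. \<Sum>s\<in>J. cnj (E r i) * E s j * f (u r) (w s))"
    if "i \<in> I" "j \<in> I" for i j
    unfolding x[OF that(1)] y[OF that(2)] sesquilinear_sum(1)[OF f] sesquilinearD(3)[OF f]
    unfolding sesquilinear_sum(2)[OF f] sesquilinearD(4)[OF f]
    by (simp add: sum_distrib_left mult.assoc)
  then have "block_form I M f x y
      = (\<Sum>i\<in>I. \<Sum>j\<in>I. \<Sum>r\<in>J. \<Sum>s\<in>J. M i j * cnj (E r i) * E s j * f (u r) (w s))"
    unfolding block_form_def by (intro sum.cong refl) (simp add: sum_distrib_left mult.assoc)
  also have "\<dots> = (\<Sum>i\<in>I. \<Sum>r\<in>J. \<Sum>j\<in>I. \<Sum>s\<in>J. M i j * cnj (E r i) * E s j * f (u r) (w s))"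
    by (intro sum.cong refl sum.swap)
  also have "\<dots> = (\<Sum>r\<in>J. \<Sum>i\<in>I. \<Sum>j\<in>I. \<Sum>s\<in>J. M i j * cnj (E r i) * E s j * f (u r) (w s))"
    by (rule sum.swap)
  also have "\<dots> = (\<Sum>r\<in>J. \<Sum>i\<in>I. \<Sum>s\<in>J. \<Sum>j\<in>I. M i j * cnj (E r i) * E s j * f (u r) (w s))"
    by (intro sum.cong refl sum.swap)
  also have "\<dots> = (\<Sum>r\<in>J. \<Sum>s\<in>J. \<Sum>i\<in>I. \<Sum>j\<in>I. M i j * cnj (E r i) * E s j * f (u r) (w s))"
    by (intro sum.cong refl sum.swap)
  also have "\<dots> = block_form J (\<lambda>r s. matrix_form I M (E r) (E s)) f u w"
    unfolding block_form_def
    by (simp add: cinner_complex_def sum_distrib_right sum_distrib_left algebra_simps)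
  finally show ?thesis .
qed

section \<open>Simultaneous diagonalisation by congruence\<close>

lemma nonneg_quadratic_imp_linear_zero:
  fixes b d :: real
  assumes "\<And>t. 0 \<le> 2 * t * b + t\<^sup>2 * d"
  shows "b = 0"
proof (rule ccontr)
  assume b: "b \<noteq> 0"
  define t where "t = - b / (\<bar>d\<bar> + 1)"
  have "t\<^sup>2 * d \<le> t\<^sup>2 * (\<bar>d\<bar> + 1)" by (intro mult_left_mono) auto
  also have "\<dots> = t * (t * (\<bar>d\<bar> + 1))" by (simp add: power2_eq_square)
  also have "t * (\<bar>d\<bar> + 1) = - b" by (simp add: t_def)
  finally have "0 \<le> t * b" using assms[of t] by simp
  also have "t * b = - (b\<^sup>2 / (\<bar>d\<bar> + 1))" by (simp add: t_def power2_eq_square)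
  also have "\<dots> < 0" using b by (simp add: add_nonneg_pos)
  finally show False by simp
qed

text \<open>
  Moving from \<open>f\<close> in a suitable direction \<open>y\<close> changes the value of the form by a linear and a
  quadratic term; at a minimum the linear term vanishes.
\<close>

lemma psd_isotropic_imp_kernel:
  assumes N: "hermitian_on I N"
    and psd: "\<And>x. 0 \<le> Re (matrix_form I N x x)"
    and f: "Re (matrix_form I N f f) = 0"
  shows "matrix_form I N f x = 0"
proof -
  define c where "c = matrix_form I N f x"
  \<comment> \<open>the phase of \<open>x\<close> is rotated so that the linear term is the real number \<open>\<bar>c\<bar>\<^sup>2\<close>\<close>
  define y where "y = (\<lambda>i. cnj c *\<^sub>C x i)"
  note sc = block_form_scale[OF sesquilinear_cinner[where 'a=complex]]
    block_form_add[OF sesquilinear_cinner[where 'a=complex]]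
  have fy: "matrix_form I N f y = of_real ((cmod c)\<^sup>2)"
    by (simp only: y_def sc c_def[symmetric])
      (metis complex_norm_square mult.commute)
  have yf: "matrix_form I N y f = of_real ((cmod c)\<^sup>2)"
    using matrix_form_commute[OF N, of y f] fy by simp
  have "0 \<le> 2 * t * (cmod c)\<^sup>2 + t\<^sup>2 * Re (matrix_form I N y y)" for t
  proof -
    have "matrix_form I N (\<lambda>i. f i + of_real t *\<^sub>C y i) (\<lambda>i. f i + of_real t *\<^sub>C y i)
        = matrix_form I N f f + of_real t * matrix_form I N f y + of_real t * matrix_form I N y f
          + of_real (t\<^sup>2) * matrix_form I N y y"
      by (simp only: sc) (simp add: algebra_simps power2_eq_square)
    then show ?thesis
      using psd[of "\<lambda>i. f i + of_real t *\<^sub>C y i"] f by (simp add: fy yf)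
  qed
  then have "(cmod c)\<^sup>2 = 0" by (rule nonneg_quadratic_imp_linear_zero)
  then show ?thesis by (simp add: c_def)
qed

text \<open>
  The index set is an arbitrary finite set, not a type, so the sphere lives in a function space;
  Tychonoff's theorem for the product topology gives compactness.
\<close>

lemma compact_coordinate_sphere:
  fixes I :: "'i set"
  shows "compact {x :: 'i \<Rightarrow> complex. (\<forall>i. i \<notin> I \<longrightarrow> x i = 0) \<and> (\<forall>i\<in>I. cmod (x i) \<le> 1) \<and>
    (\<Sum>i\<in>I. (cmod (x i))\<^sup>2) = 1}"
proof -
  define T :: "'i \<Rightarrow> complex set" where "T = (\<lambda>i. if i \<in> I then cball 0 1 else {0})"
  have "compactin (product_topology (\<lambda>_. euclidean) UNIV) (PiE UNIV T)"
    by (subst compactin_PiE) (auto simp: T_def)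
  then have "compact (PiE UNIV T)"
    by (simp add: euclidean_product_topology)
  moreover have "closed {x :: 'i \<Rightarrow> complex. (\<Sum>i\<in>I. (cmod (x i))\<^sup>2) = 1}"
    by (intro closed_Collect_eq continuous_intros continuous_on_product_coordinates)
  ultimately have "compact (PiE UNIV T \<inter> {x. (\<Sum>i\<in>I. (cmod (x i))\<^sup>2) = 1})"
    by (rule compact_Int_closed)
  also have "PiE UNIV T \<inter> {x. (\<Sum>i\<in>I. (cmod (x i))\<^sup>2) = 1} =
      {x. (\<forall>i. i \<notin> I \<longrightarrow> x i = 0) \<and> (\<forall>i\<in>I. cmod (x i) \<le> 1) \<and> (\<Sum>i\<in>I. (cmod (x i))\<^sup>2) = 1}"
    by (auto simp: PiE_iff T_def split: if_splits)
  finally show ?thesis .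
qed

lemma continuous_on_matrix_form: "continuous_on UNIV (\<lambda>x. matrix_form I M x x)"
  unfolding block_form_def cinner_complex_def
  by (intro continuous_intros continuous_on_product_coordinates)

text \<open>
  The Rayleigh quotient of \<open>Z\<close> against \<open>H\<close> attains its maximum \<open>\<mu>\<close> at some \<open>v\<close>. Then
  \<open>N = \<mu> H - Z\<close> is positive semidefinite and vanishes at \<open>v\<close>, so \<open>v\<close> lies in its kernel.
\<close>

lemma exists_generalised_eigenvector:
  assumes fin: "finite I" and ne: "I \<noteq> {}"
    and H: "hermitian_on I H" and Z: "hermitian_on I Z"
    and pos: "positive_definite_on I H"
  shows "\<exists>v (\<mu>::real). (\<exists>i\<in>I. v i \<noteq> 0) \<and>
    (\<forall>x. matrix_form I Z v x = of_real \<mu> * matrix_form I H v x)"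
proof -
  define S where "S = {x :: 'a \<Rightarrow> complex. (\<forall>i. i \<notin> I \<longrightarrow> x i = 0) \<and> (\<forall>i\<in>I. cmod (x i) \<le> 1) \<and>
    (\<Sum>i\<in>I. (cmod (x i))\<^sup>2) = 1}"
  note sc = block_form_scale[OF sesquilinear_cinner[where 'a=complex]]
  have S0: "\<exists>i\<in>I. x i \<noteq> 0" if "x \<in> S" for x
  proof (rule ccontr)
    assume "\<not> ?thesis"
    then have "(\<Sum>i\<in>I. (cmod (x i))\<^sup>2) = 0" by (intro sum.neutral) auto
    with that show False by (simp add: S_def)
  qed
  have posS: "0 < Re (matrix_form I H x x)" if "x \<in> S" for x
    using S0[OF that] pos by (simp add: positive_definite_on_def)
  obtain i0 where i0: "i0 \<in> I" using ne by auto
  have "(\<Sum>i\<in>I. (cmod (if i = i0 then 1 else 0))\<^sup>2) = (\<Sum>i\<in>I. if i = i0 then 1 else 0)"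
    by (intro sum.cong) auto
  then have "(\<lambda>i. if i = i0 then 1 else 0) \<in> S"
    using i0 fin by (auto simp: S_def)
  then have "S \<noteq> {}" by blast
  have cont: "continuous_on S (\<lambda>x. Re (matrix_form I M x x))" for M
    by (intro continuous_on_Re continuous_on_subset[OF continuous_on_matrix_form] subset_UNIV)
  have "continuous_on S (\<lambda>x. Re (matrix_form I Z x x) / Re (matrix_form I H x x))"
    by (intro continuous_on_divide cont ballI) (use posS in fastforce)
  from continuous_attains_sup[OF compact_coordinate_sphere[of I, folded S_def] \<open>S \<noteq> {}\<close> this]
  obtain v where vS: "v \<in> S"
    and vmax: "\<forall>x\<in>S. Re (matrix_form I Z x x) / Re (matrix_form I H x x)
        \<le> Re (matrix_form I Z v v) / Re (matrix_form I H v v)"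
    by (elim bexE)
  define \<mu> where "\<mu> = Re (matrix_form I Z v v) / Re (matrix_form I H v v)"
  define N where "N = (\<lambda>i j. of_real \<mu> * H i j + (-1) * Z i j)"
  have Nform: "matrix_form I N x y = of_real \<mu> * matrix_form I H x y - matrix_form I Z x y" for x y
    unfolding N_def block_form_lincomb by simp
  have "hermitian_on I N"
    unfolding hermitian_on_def N_def
    by (simp add: hermitian_onD[OF H, symmetric] hermitian_onD[OF Z, symmetric])
  moreover have "0 \<le> Re (matrix_form I N x x)" for x
  proof (cases "\<exists>i\<in>I. x i \<noteq> 0")
    case False
    then show ?thesis by (simp add: block_form_def cinner_complex_def)
  next
    case True
    define n where "n = (\<Sum>i\<in>I. (cmod (x i))\<^sup>2)"
    from True obtain i where "i \<in> I" "x i \<noteq> 0" by blast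
    with fin have n: "0 < n" unfolding n_def by (intro sum_pos2[of I i]) auto
    define z where "z = (\<lambda>i. complex_of_real (1 / sqrt n) *\<^sub>C x i)"
    define y where "y = (\<lambda>i. if i \<in> I then z i else 0)"
    have "(cmod (y i))\<^sup>2 = (cmod (x i))\<^sup>2 / n" if "i \<in> I" for i
      using n that by (simp add: y_def z_def scaleC_complex_def norm_divide power_divide)
    then have ysum: "(\<Sum>i\<in>I. (cmod (y i))\<^sup>2) = 1"
      using n by (simp flip: sum_divide_distrib n_def)
    have "(cmod (y i))\<^sup>2 \<le> 1" if "i \<in> I" for i
      using member_le_sum[of i I "\<lambda>i. (cmod (y i))\<^sup>2"] that fin ysum by auto
    then have "cmod (y i) \<le> 1" if "i \<in> I" for i
      using that by (simp add: power2_le_imp_le)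
    with ysum have yS: "y \<in> S" by (auto simp: y_def S_def)
    have scale: "Re (matrix_form I M y y) = Re (matrix_form I M x x) / n" for M
    proof -
      have "matrix_form I M y y = matrix_form I M z z"
        by (rule block_form_cong) (auto simp: y_def)
      also have "\<dots> = of_real (1 / n) * matrix_form I M x x"
        unfolding z_def sc using n
        by (simp add: field_simps flip: of_real_mult)
      finally show ?thesis by simp
    qed
    have "Re (matrix_form I Z y y) \<le> \<mu> * Re (matrix_form I H y y)"
      using bspec[OF vmax yS] posS[OF yS] by (simp add: \<mu>_def pos_divide_le_eq)
    then show ?thesis using n by (simp add: scale Nform field_simps)
  qed
  moreover have "Re (matrix_form I N v v) = 0"
    using posS[OF vS] by (simp add: Nform \<mu>_def)
  ultimately have "matrix_form I N v x = 0" for x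
    by (rule psd_isotropic_imp_kernel)
  then have "\<forall>x. matrix_form I Z v x = of_real \<mu> * matrix_form I H v x"
    by (simp add: Nform)
  with S0[OF vS] show ?thesis by blast
qed

lemma block_form_diagonal:
  assumes "finite I" "\<And>i j. i \<in> I \<Longrightarrow> j \<in> I \<Longrightarrow> i \<noteq> j \<Longrightarrow> M i j = 0"
  shows "block_form I M f x y = (\<Sum>i\<in>I. M i i * f (x i) (y i))"
proof -
  have "(\<Sum>j\<in>I. M i j * f (x i) (y j)) = M i i * f (x i) (y i)" if "i \<in> I" for i
  proof -
    have "(\<Sum>j\<in>I. M i j * f (x i) (y j)) = (\<Sum>j\<in>I. if i = j then M i i * f (x i) (y i) else 0)"
      using assms(2) that by (intro sum.cong) auto
    then show ?thesis using assms(1) that by simp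
  qed
  then show ?thesis by (simp add: block_form_def)
qed

lemma matrix_form_identity:
  assumes "finite I"
  shows "matrix_form I (\<lambda>i j. if i = j then 1 else 0) c c = of_real (\<Sum>i\<in>I. (cmod (c i))\<^sup>2)"
  using assms
  by (subst block_form_diagonal)
    (simp_all add: cinner_complex_def mult.commute[of "cnj _"] flip: complex_norm_square)

lemma matrix_form_lincomb_right:
  "matrix_form I M x (\<lambda>i. \<Sum>r\<in>J. E r i * d r) = (\<Sum>r\<in>J. matrix_form I M x (E r) * d r)"
proof -
  have "matrix_form I M x (\<lambda>i. \<Sum>r\<in>J. E r i * d r)
      = (\<Sum>i\<in>I. \<Sum>j\<in>I. \<Sum>r\<in>J. M i j * cinner (x i) (E r j) * d r)"
    by (simp add: block_form_def cinner_complex_def sum_distrib_left mult.assoc)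
  also have "\<dots> = (\<Sum>i\<in>I. \<Sum>r\<in>J. \<Sum>j\<in>I. M i j * cinner (x i) (E r j) * d r)"
    by (intro sum.cong refl sum.swap)
  also have "\<dots> = (\<Sum>r\<in>J. \<Sum>i\<in>I. \<Sum>j\<in>I. M i j * cinner (x i) (E r j) * d r)"
    by (rule sum.swap)
  finally show ?thesis
    by (simp add: block_form_def sum_distrib_right)
qed

text \<open>
  Induction on the index set: split off a generalised eigenvector \<open>v\<close> and pass to its
  \<open>H\<close>-orthogonal complement, which is also \<open>Z\<close>-orthogonal to \<open>v\<close>. If \<open>v m \<noteq> 0\<close>, then the
  projections of the unit vectors other than the \<open>m\<close>-th form a basis of the complement, so the
  induction continues with the index set \<open>I - {m}\<close>. The last conjunct says that the columns
  \<open>F l\<close> span, which stands for the invertibility of the congruence.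
\<close>

lemma simultaneous_diagonalisation_scalars:
  assumes "finite I" "hermitian_on I H" "hermitian_on I Z"
    and "positive_definite_on I H"
  shows "\<exists>F. (\<forall>l\<in>I. \<forall>m\<in>I. l \<noteq> m \<longrightarrow>
        matrix_form I H (F l) (F m) = 0 \<and> matrix_form I Z (F l) (F m) = 0) \<and>
      (\<forall>c. \<exists>d. \<forall>i\<in>I. c i = (\<Sum>l\<in>I. F l i * d l))"
  using assms
proof (induction I arbitrary: H Z rule: finite_psubset_induct)
  case (psubset I)
  note H = psubset.prems(1) and Z = psubset.prems(2) and pos = psubset.prems(3)
  show ?case
  proof (cases "I = {}")
    case True
    then show ?thesis by simp
  next
    case False
    obtain v \<mu> m where m: "m \<in> I" "v m \<noteq> 0"
      and eig: "\<And>x. matrix_form I Z v x = of_real \<mu> * matrix_form I H v x"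
      using exists_generalised_eigenvector[OF psubset.hyps(1) False H Z pos] by blast
    define h where "h = matrix_form I H v v"
    have h: "h \<noteq> 0" using pos m by (auto simp: h_def positive_definite_on_def)
    define e :: "'a \<Rightarrow> 'a \<Rightarrow> complex" where "e = (\<lambda>r i. if i = r then 1 else 0)"
    \<comment> \<open>\<open>E r\<close> is the projection of the unit vector \<open>e r\<close> along \<open>v\<close>, orthogonal with respect to \<open>H\<close>\<close>
    define \<alpha> where "\<alpha> r = matrix_form I H v (e r) / h" for r
    define E where "E r = (\<lambda>i. e r i + (- \<alpha> r) *\<^sub>C v i)" for r
    define J where "J = I - {m}"
    have J: "J \<subset> I" "finite J" "I = insert m J" "m \<notin> J"
      using m psubset.hyps by (auto simp: J_def)
    note sc = block_form_scale[OF sesquilinear_cinner[where 'a=complex]]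
      block_form_add[OF sesquilinear_cinner[where 'a=complex]]
    have HvE: "matrix_form I H v (E r) = 0" for r
      unfolding E_def sc using h by (simp add: \<alpha>_def flip: h_def)
    have ZvE: "matrix_form I Z v (E r) = 0" for r
      by (simp add: eig HvE)
    have sumE: "(\<Sum>r\<in>J. E r i * d r) = (if i \<in> J then d i else 0) - (\<Sum>r\<in>J. \<alpha> r * d r) * v i"
      for i d
    proof -
      have "(\<Sum>r\<in>J. E r i * d r) = (\<Sum>r\<in>J. (if i = r then d i else 0) - \<alpha> r * d r * v i)"
        by (intro sum.cong refl) (simp add: E_def e_def scaleC_complex_def algebra_simps)
      then show ?thesis
        using J(2) by (simp add: sum_subtractf sum_distrib_right)
    qed
    define H' where "H' = (\<lambda>r s. matrix_form I H (E r) (E s))"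
    define Z' where "Z' = (\<lambda>r s. matrix_form I Z (E r) (E s))"
    have base: "matrix_form I M (\<lambda>i. \<Sum>r\<in>J. E r i * c r) (\<lambda>i. \<Sum>r\<in>J. E r i * d r)
        = matrix_form J (\<lambda>r s. matrix_form I M (E r) (E s)) c d" for M c d
      by (rule block_form_change_basis[OF sesquilinear_cinner]) (simp_all add: scaleC_complex_def)
    have H': "hermitian_on J H'"
      unfolding hermitian_on_def H'_def using matrix_form_commute[OF H] by blast
    have Z': "hermitian_on J Z'"
      unfolding hermitian_on_def Z'_def using matrix_form_commute[OF Z] by blast
    have pos': "positive_definite_on J H'"
      unfolding positive_definite_on_def
    proof (intro allI impI)
      fix c :: "'a \<Rightarrow> complex"
      assume "\<exists>i\<in>J. c i \<noteq> 0"
      then obtain i where i: "i \<in> J" "c i \<noteq> 0" by blast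
      define x where "x = (\<lambda>i. \<Sum>r\<in>J. E r i * c r)"
      have "\<exists>k\<in>I. x k \<noteq> 0"
      proof (cases "(\<Sum>r\<in>J. \<alpha> r * c r) = 0")
        case True
        then have "x i \<noteq> 0" using i by (simp add: x_def sumE)
        then show ?thesis using i J by blast
      next
        case False
        then have "x m \<noteq> 0" using m J by (simp add: x_def sumE)
        then show ?thesis using m by blast
      qed
      then have "0 < Re (matrix_form I H x x)" using pos by (simp add: positive_definite_on_def)
      then show "0 < Re (matrix_form J H' c c)" by (simp add: x_def base H'_def)
    qed
    have "\<exists>F. (\<forall>l\<in>J. \<forall>k\<in>J. l \<noteq> k \<longrightarrow>
          matrix_form J H' (F l) (F k) = 0 \<and> matrix_form J Z' (F l) (F k) = 0) \<and>
        (\<forall>c. \<exists>d. \<forall>i\<in>J. c i = (\<Sum>l\<in>J. F l i * d l))"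
      by (rule psubset.IH[OF J(1) H' Z' pos'])
    then obtain F where
      F: "\<And>l k. l \<in> J \<Longrightarrow> k \<in> J \<Longrightarrow> l \<noteq> k \<Longrightarrow>
           matrix_form J H' (F l) (F k) = 0 \<and> matrix_form J Z' (F l) (F k) = 0"
      and surj: "\<And>c. \<exists>d. \<forall>i\<in>J. c i = (\<Sum>l\<in>J. F l i * d l)"
      by blast
    define G where "G l = (if l = m then v else (\<lambda>i. \<Sum>r\<in>J. E r i * F l r))" for l
    have Gm: "G m = v" by (simp add: G_def)
    have GJ: "G l = (\<lambda>i. \<Sum>r\<in>J. E r i * F l r)" if "l \<in> J" for l
      using that J by (auto simp: G_def)
    have "matrix_form I H (G l) (G k) = 0 \<and> matrix_form I Z (G l) (G k) = 0"
      if lk: "l \<in> I" "k \<in> I" "l \<noteq> k" for l k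
    proof -
      have vG: "matrix_form I H v (G k) = 0 \<and> matrix_form I Z v (G k) = 0" if "k \<in> J" for k
        by (simp add: GJ[OF that] matrix_form_lincomb_right HvE ZvE)
      consider "l \<in> J" "k \<in> J" | "l = m" "k \<in> J" | "l \<in> J" "k = m"
        using lk J by blast
      then show ?thesis
      proof cases
        case 1
        then show ?thesis using F[OF 1 lk(3)] by (simp add: GJ base H'_def Z'_def)
      next
        case 2
        then show ?thesis using vG by (simp add: Gm)
      next
        case 3
        then show ?thesis
          using vG[OF 3(1)] matrix_form_commute[OF H, of "G l" v] matrix_form_commute[OF Z, of "G l" v]
          by (simp add: Gm)
      qed
    qed
    moreover have "\<exists>d. \<forall>i\<in>I. c i = (\<Sum>l\<in>I. G l i * d l)" for c
    proof -
      \<comment> \<open>subtracting \<open>s v\<close> kills the \<open>m\<close>-th coordinate, and the rest is expanded over \<open>J\<close>\<close>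
      define s where "s = c m / v m"
      define b where "b i = c i - s * v i" for i
      obtain d where d: "\<And>i. i \<in> J \<Longrightarrow> b i = (\<Sum>l\<in>J. F l i * d l)"
        using surj[of b] by blast
      define d' where "d' l = (if l = m then s + (\<Sum>r\<in>J. \<alpha> r * b r) else d l)" for l
      have "c i = (\<Sum>l\<in>I. G l i * d' l)" if "i \<in> I" for i
      proof -
        have "(\<Sum>l\<in>J. G l i * d' l) = (\<Sum>l\<in>J. (\<Sum>r\<in>J. E r i * F l r) * d l)"
          using J by (intro sum.cong refl) (auto simp: GJ d'_def)
        also have "\<dots> = (\<Sum>l\<in>J. \<Sum>r\<in>J. E r i * (F l r * d l))"
          by (simp add: sum_distrib_right mult.assoc)
        also have "\<dots> = (\<Sum>r\<in>J. \<Sum>l\<in>J. E r i * (F l r * d l))"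
          by (rule sum.swap)
        also have "\<dots> = (\<Sum>r\<in>J. E r i * b r)"
          using d by (intro sum.cong refl) (simp add: sum_distrib_left)
        finally have "(\<Sum>l\<in>I. G l i * d' l) = v i * d' m + (\<Sum>r\<in>J. E r i * b r)"
          using J by (simp add: Gm)
        also have "\<dots> = v i * s + (if i \<in> J then b i else 0)"
          unfolding sumE d'_def by (simp add: algebra_simps)
        also have "\<dots> = c i"
          using that J m by (auto simp: b_def s_def)
        finally show ?thesis by simp
      qed
      then show ?thesis by blast
    qed
    ultimately show ?thesis by blast
  qed
qed

text \<open>
  The coefficients that expand the unit vectors in the columns \<open>F l\<close> form a right inverse \<open>G\<close> of
  the congruence, and \<open>G\<close> also gives the coordinates of families of vectors in any complex space.
\<close>

lemma simultaneous_diagonalisation: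
  fixes I :: "'i set"
  assumes fin: "finite I" and "hermitian_on I H" "hermitian_on I Z"
    and "positive_definite_on I H"
  shows "\<exists>F. (\<forall>l\<in>I. \<forall>m\<in>I. l \<noteq> m \<longrightarrow>
        matrix_form I H (F l) (F m) = 0 \<and> matrix_form I Z (F l) (F m) = 0) \<and>
      (\<forall>x :: 'i \<Rightarrow> 'a::complex_vector. \<exists>y. \<forall>i\<in>I. x i = (\<Sum>l\<in>I. F l i *\<^sub>C y l))"
proof -
  obtain F where diag: "\<forall>l\<in>I. \<forall>m\<in>I. l \<noteq> m \<longrightarrow>
        matrix_form I H (F l) (F m) = 0 \<and> matrix_form I Z (F l) (F m) = 0"
    and "\<forall>c. \<exists>d. \<forall>i\<in>I. c i = (\<Sum>l\<in>I. F l i * d l)"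
    using simultaneous_diagonalisation_scalars[OF assms] by blast
  then have "\<forall>j. \<exists>d. \<forall>i\<in>I. (if i = j then 1 else 0) = (\<Sum>l\<in>I. F l i * d l)"
    by (auto dest: spec[of _ "\<lambda>i. if i = _ then 1 else 0"])
  then obtain G where G: "\<And>i j. i \<in> I \<Longrightarrow> (\<Sum>l\<in>I. F l i * G j l) = (if i = j then 1 else 0)"
    by metis
  have expand: "x i = (\<Sum>l\<in>I. F l i *\<^sub>C (\<Sum>j\<in>I. G j l *\<^sub>C x j))" if "i \<in> I" for i and x :: "'i \<Rightarrow> 'a"
  proof -
    have "(\<Sum>l\<in>I. F l i *\<^sub>C (\<Sum>j\<in>I. G j l *\<^sub>C x j)) = (\<Sum>l\<in>I. \<Sum>j\<in>I. (F l i * G j l) *\<^sub>C x j)"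
      by (simp add: complex_vector.scale_sum_right)
    also have "\<dots> = (\<Sum>j\<in>I. \<Sum>l\<in>I. (F l i * G j l) *\<^sub>C x j)"
      by (rule sum.swap)
    also have "\<dots> = (\<Sum>j\<in>I. if i = j then x j else 0)"
      by (intro sum.cong refl) (simp add: G[OF that] flip: complex_vector.scale_sum_left)
    finally show ?thesis using fin that by simp
  qed
  then have "\<exists>y. \<forall>i\<in>I. x i = (\<Sum>l\<in>I. F l i *\<^sub>C y l)" for x :: "'i \<Rightarrow> 'a"
    by (intro exI[of _ "\<lambda>l. \<Sum>j\<in>I. G j l *\<^sub>C x j"]) blast
  with diag show ?thesis by blast
qed

text \<open>
  Diagonalising \<open>N\<close> reduces the claim to a sum of values of \<open>q\<close> with nonnegative weights.
\<close>

lemma psd_block_form_nonneg: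
  fixes I :: "'i set" and q :: "'a::complex_vector \<Rightarrow> 'a \<Rightarrow> complex"
  assumes fin: "finite I" and N: "hermitian_on I N" and psd: "\<And>c. 0 \<le> matrix_form I N c c"
    and q: "sesquilinear q" and qpos: "\<And>x. 0 \<le> q x x"
  shows "0 \<le> block_form I N q x x"
proof -
  let ?one = "\<lambda>i j :: 'i. if i = j then 1 else 0 :: complex"
  have pd: "positive_definite_on I ?one"
    unfolding positive_definite_on_def matrix_form_identity[OF fin]
    using fin by (auto intro: sum_pos2)
  have herm: "hermitian_on I ?one"
    by (simp add: hermitian_on_def)
  obtain F where
    F: "\<And>l m. l \<in> I \<Longrightarrow> m \<in> I \<Longrightarrow> l \<noteq> m \<Longrightarrow> matrix_form I N (F l) (F m) = 0"
    and surj: "\<And>x :: 'i \<Rightarrow> 'a. \<exists>y. \<forall>i\<in>I. x i = (\<Sum>l\<in>I. F l i *\<^sub>C y l)"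
    using simultaneous_diagonalisation[OF fin herm N pd, where 'a='a] by blast
  obtain y where y: "\<And>i. i \<in> I \<Longrightarrow> x i = (\<Sum>l\<in>I. F l i *\<^sub>C y l)"
    using surj by blast
  have "block_form I N q x x = block_form I (\<lambda>l m. matrix_form I N (F l) (F m)) q y y"
    by (rule block_form_change_basis[OF q y y])
  also have "\<dots> = (\<Sum>l\<in>I. matrix_form I N (F l) (F l) * q (y l) (y l))"
    by (rule block_form_diagonal[OF fin F])
  also have "0 \<le> \<dots>"
    by (intro sum_nonneg mult_nonneg_nonneg psd qpos)
  finally show ?thesis .
qed

lemma nonneg_of_eps:
  fixes b s :: real
  assumes "\<And>\<delta>. 0 < \<delta> \<Longrightarrow> - s * \<delta> \<le> b"
  shows "0 \<le> b"
proof (rule ccontr)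
  assume "\<not> 0 \<le> b"
  then have b: "b < 0" by simp
  have "- s * (- b / (2 * (\<bar>s\<bar> + 1))) \<le> b" using b by (intro assms) (auto intro: divide_neg_pos)
  then have "s * b \<le> 2 * b * (\<bar>s\<bar> + 1)" by (simp add: field_simps)
  moreover have "s * b \<ge> \<bar>s\<bar> * b" using b by (simp add: mult_right_mono_neg)
  moreover have "\<bar>s\<bar> * b \<le> 0" using b by (simp add: mult_nonneg_nonpos)
  ultimately show False using b by (simp add: algebra_simps)
qed

section \<open>Transfer of positivity for pencils with a rank one term\<close>

lemma complex_nonneg_iff: "0 \<le> (z::complex) \<longleftrightarrow> 0 \<le> Re z \<and> Im z = 0"
  by (auto simp: less_eq_complex_def)

text \<open>
  The forms \<open>g\<close> and \<open>a\<close> stand for \<open>\<langle>u, w\<rangle>\<close> and \<open>\<langle>u, A w\<rangle>\<close>, the functional \<open>\<phi>\<close> for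
  \<open>\<langle>v, u\<rangle>\<close>, so that \<open>\<langle>u, P w\<rangle>\<close> is \<open>cnj (\<phi> u) * \<phi> w\<close>; the vector \<open>e\<close> is a unit vector orthogonal to \<open>v\<close>. The forms \<open>g'\<close>, \<open>a'\<close> and \<open>q\<close> stand for
  \<open>\<langle>x, y\<rangle>\<close>, \<open>\<langle>x, \<Phi>(A) y\<rangle>\<close> and \<open>\<langle>x, \<Phi>(P) y\<rangle>\<close>. The assumption \<open>cone\<close> is the positivity of
  \<open>\<Phi>\<close> on the self-adjoint elements \<open>\<xi> I + \<eta> P + \<zeta> A\<close>.
\<close>

locale rank_one_pencil =
  fixes g a :: "'v::complex_vector \<Rightarrow> 'v \<Rightarrow> complex" and \<phi> :: "'v \<Rightarrow> complex" and e :: 'v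
    and g' a' q :: "'k::complex_vector \<Rightarrow> 'k \<Rightarrow> complex"
  assumes sesq: "sesquilinear g" "sesquilinear a"
    and sesq': "sesquilinear g'" "sesquilinear a'" "sesquilinear q"
    and \<phi>: "\<And>c u. \<phi> (c *\<^sub>C u) = c * \<phi> u" "\<And>u w. \<phi> (u + w) = \<phi> u + \<phi> w"
    and \<phi>_surj: "\<exists>u. \<phi> u = 1"
    and e: "\<phi> e = 0" "g e e = 1" "Im (a e e) = 0"
    and g_nonneg: "\<And>u. 0 \<le> g u u"
    and cone: "\<And>\<xi> \<eta> \<zeta> x. (\<And>u. 0 \<le> of_real \<xi> * g u u + of_real \<eta> * (cnj (\<phi> u) * \<phi> u) + of_real \<zeta> * a u u) \<Longrightarrow>
        0 \<le> of_real \<xi> * g' x x + of_real \<eta> * q x x + of_real \<zeta> * a' x x"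
begin

abbreviation p :: "'v \<Rightarrow> 'v \<Rightarrow> complex" where "p u w \<equiv> cnj (\<phi> u) * \<phi> w"

lemma \<phi>_0: "\<phi> 0 = 0"
  using \<phi>(1)[of 0 0] by simp

lemma sesq_p: "sesquilinear p"
  by (auto simp: sesquilinear_def \<phi> algebra_simps)

lemma q_nonneg: "0 \<le> q x x"
  using cone[of 0 1 0 x] by (simp add: less_eq_complex_def)

text \<open>
  When only \<open>Y\<close> couples the blocks, each diagonal block is completed to a positive element
  \<open>B l + \<eta> l P\<close> with the least possible \<open>\<eta> l\<close>, and what remains of \<open>Y\<close> is positive
  semidefinite by the optimality of \<open>\<eta>\<close>.
\<close>

lemma positivity_transfer_diagonal:
  fixes \<xi> \<zeta> :: "'i \<Rightarrow> real"
  assumes fin: "finite I" and Y: "hermitian_on I Y"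
    and T: "\<And>u. 0 \<le> (\<Sum>l\<in>I. of_real (\<xi> l) * g (u l) (u l) + of_real (\<zeta> l) * a (u l) (u l))
      + block_form I Y p u u"
  shows "0 \<le> (\<Sum>l\<in>I. of_real (\<xi> l) * g' (x l) (x l) + of_real (\<zeta> l) * a' (x l) (x l))
      + block_form I Y q x x"
proof -
  define B where "B l u = of_real (\<xi> l) * g u u + of_real (\<zeta> l) * a u u" for l u
  have B0: "B l 0 = 0" for l
    by (simp add: B_def sesquilinear_0[OF sesq(1)] sesquilinear_0[OF sesq(2)])
  have B_scale: "B l (c *\<^sub>C u) = of_real ((cmod c)\<^sup>2) * B l u" for l c u
  proof -
    have "B l (c *\<^sub>C u) = (c * cnj c) * B l u"
      by (simp add: B_def sesquilinearD[OF sesq(1)] sesquilinearD[OF sesq(2)] algebra_simps)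
    then show ?thesis by (simp only: complex_norm_square)
  qed
  have Yreal: "Im (Y l l) = 0" if "l \<in> I" for l
    using hermitian_onD[OF Y that that] by (metis Reals_cnj_iff complex_is_Real_iff)
  \<comment> \<open>a vector supported in one block bounds \<open>\<eta> l\<close> by \<open>Y l l\<close>, so the supremum below is finite\<close>
  have single: "0 \<le> B l w + Y l l * of_real ((cmod (\<phi> w))\<^sup>2)" if l: "l \<in> I" for l w
  proof -
    define u where "u k = (if k = l then w else 0)" for k
    have "(\<Sum>k\<in>I. B k (u k)) = (\<Sum>k\<in>I. if k = l then B l w else 0)"
      by (intro sum.cong refl) (simp add: u_def B0)
    also have "\<dots> = B l w" using fin l by simp
    finally have 1: "(\<Sum>k\<in>I. B k (u k)) = B l w" .
    have "block_form I Y p u u = (\<Sum>i\<in>I. \<Sum>j\<in>I. if j = l then (if i = l then Y l l * p w w else 0) else 0)"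
      unfolding block_form_def by (intro sum.cong refl) (simp add: u_def \<phi>_0)
    also have "\<dots> = Y l l * p w w" using fin l by simp
    finally have "0 \<le> B l w + Y l l * p w w"
      using T[of u] 1 by (simp add: B_def)
    then show ?thesis by (simp only: complex_norm_square mult.commute[of "cnj _"])
  qed
  have B_real: "Im (B l w) = 0" if "l \<in> I" for l w
    using single[OF that, of w] Yreal[OF that] by (simp add: complex_nonneg_iff)
  have single_Re: "0 \<le> Re (B l w) + Re (Y l l) * (cmod (\<phi> w))\<^sup>2" if "l \<in> I" for l w
    using single[OF that, of w] by (simp add: complex_nonneg_iff)
  define W where "W = {w. \<phi> w = 1}"
  have W: "W \<noteq> {}" using \<phi>_surj by (auto simp: W_def)
  define \<eta> where "\<eta> l = (SUP w\<in>W. - Re (B l w))" for l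
  have bdd: "bdd_above ((\<lambda>w. - Re (B l w)) ` W)" if "l \<in> I" for l
  proof (rule bdd_aboveI2)
    show "- Re (B l w) \<le> Re (Y l l)" if "w \<in> W" for w
      using single_Re[OF \<open>l \<in> I\<close>, of w] that by (simp add: W_def)
  qed
  have \<eta>_pos: "0 \<le> of_real (\<xi> l) * g w w + of_real (\<eta> l) * p w w + of_real (\<zeta> l) * a w w"
    if l: "l \<in> I" for l w
  proof -
    have "0 \<le> Re (B l w) + \<eta> l * (cmod (\<phi> w))\<^sup>2"
    proof (cases "\<phi> w = 0")
      case True
      then show ?thesis using single_Re[OF l, of w] by simp
    next
      case False
      have "(1 / \<phi> w) *\<^sub>C w \<in> W" using False by (simp add: W_def \<phi>)
      then have "- Re (B l ((1 / \<phi> w) *\<^sub>C w)) \<le> \<eta> l"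
        unfolding \<eta>_def by (rule cSUP_upper[OF _ bdd[OF l]])
      then show ?thesis using False
        by (simp add: B_scale norm_divide field_simps)
    qed
    moreover have "of_real (\<xi> l) * g w w + of_real (\<eta> l) * p w w + of_real (\<zeta> l) * a w w
        = B l w + of_real (\<eta> l * (cmod (\<phi> w))\<^sup>2)"
      unfolding B_def of_real_mult complex_norm_square by (simp add: algebra_simps)
    ultimately show ?thesis using B_real[OF l, of w] by (simp add: complex_nonneg_iff)
  qed
  define D where "D = (\<lambda>i j. if i = j then complex_of_real (\<eta> i) else 0)"
  define N where "N = (\<lambda>i j. 1 * Y i j + (-1) * D i j)"
  have N: "hermitian_on I N"
    unfolding hermitian_on_def N_def by (auto simp: D_def hermitian_onD[OF Y, symmetric])
  have Dform: "block_form I D f z z = (\<Sum>i\<in>I. of_real (\<eta> i) * f (z i) (z i))"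
    for f :: "'z \<Rightarrow> 'z \<Rightarrow> complex" and z
    by (subst block_form_diagonal[OF fin]) (auto simp: D_def)
  have Nform: "block_form I N f z z = block_form I Y f z z - (\<Sum>i\<in>I. of_real (\<eta> i) * f (z i) (z i))"
    for f :: "'z \<Rightarrow> 'z \<Rightarrow> complex" and z
    unfolding N_def block_form_lincomb Dform by simp
  have N_nonneg: "0 \<le> matrix_form I N c c" for c
  proof -
    have "- (\<delta> * (\<Sum>l\<in>I. (cmod (c l))\<^sup>2)) \<le> Re (matrix_form I N c c)" if \<delta>: "0 < \<delta>" for \<delta>
    proof -
      \<comment> \<open>the supremum need not be attained, hence vectors that are optimal up to \<open>\<delta>\<close>\<close>
      have "\<exists>w. w \<in> W \<and> \<eta> l - \<delta> < - Re (B l w)" for l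
        using less_cSupE[of "\<eta> l - \<delta>" "(\<lambda>w. - Re (B l w)) ` W"] W \<delta> by (auto simp: \<eta>_def)
      then have "\<forall>l. \<exists>w. w \<in> W \<and> \<eta> l - \<delta> < - Re (B l w)" by blast
      from choice[OF this] obtain w where "\<forall>l. w l \<in> W \<and> \<eta> l - \<delta> < - Re (B l (w l))" ..
      then have w: "\<phi> (w l) = 1" "\<eta> l - \<delta> < - Re (B l (w l))" for l
        by (auto simp: W_def)
      define u where "u l = c l *\<^sub>C w l" for l
      have "block_form I Y p u u = matrix_form I Y c c"
        by (simp add: block_form_def u_def \<phi> w cinner_complex_def)
      then have "0 \<le> Re ((\<Sum>l\<in>I. B l (u l)) + matrix_form I Y c c)"
        using T[of u] by (simp add: B_def complex_nonneg_iff)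
      moreover have "Re (matrix_form I N c c) = Re (matrix_form I Y c c) - (\<Sum>l\<in>I. \<eta> l * (cmod (c l))\<^sup>2)"
        unfolding Nform cinner_complex_def mult.commute[of "cnj _"]
        by (simp flip: complex_norm_square of_real_mult of_real_power)
      moreover have "(\<Sum>l\<in>I. Re (B l (u l)) + \<eta> l * (cmod (c l))\<^sup>2) \<le> (\<Sum>l\<in>I. \<delta> * (cmod (c l))\<^sup>2)"
      proof (rule sum_mono)
        fix l
        have "Re (B l (w l)) + \<eta> l \<le> \<delta>" using w(2)[of l] by simp
        then have "(Re (B l (w l)) + \<eta> l) * (cmod (c l))\<^sup>2 \<le> \<delta> * (cmod (c l))\<^sup>2"
          by (rule mult_right_mono) simp
        then show "Re (B l (u l)) + \<eta> l * (cmod (c l))\<^sup>2 \<le> \<delta> * (cmod (c l))\<^sup>2"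
          by (simp add: u_def B_scale algebra_simps)
      qed
      ultimately show ?thesis
        by (simp add: sum.distrib sum_distrib_left)
    qed
    then have "- (\<Sum>l\<in>I. (cmod (c l))\<^sup>2) * \<delta> \<le> Re (matrix_form I N c c)" if "0 < \<delta>" for \<delta>
      using that by (simp add: mult.commute)
    then have "0 \<le> Re (matrix_form I N c c)"
      by (rule nonneg_of_eps)
    moreover have "Im (matrix_form I N c c) = 0"
      using matrix_form_commute[OF N, of c c] by (metis Reals_cnj_iff complex_is_Real_iff)
    ultimately show ?thesis by (simp add: complex_nonneg_iff)
  qed
  have "0 \<le> (\<Sum>l\<in>I. of_real (\<xi> l) * g' (x l) (x l) + of_real (\<eta> l) * q (x l) (x l) + of_real (\<zeta> l) * a' (x l) (x l))
      + block_form I N q x x"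
    by (intro add_nonneg_nonneg sum_nonneg cone \<eta>_pos
        psd_block_form_nonneg[OF fin N N_nonneg sesq'(3) q_nonneg])
  also have "\<dots> = (\<Sum>l\<in>I. of_real (\<xi> l) * g' (x l) (x l) + of_real (\<zeta> l) * a' (x l) (x l))
      + block_form I Y q x x"
    by (simp add: Nform sum.distrib)
  finally show ?thesis .
qed

text \<open>
  The compression of \<open>T\<close> to \<open>e\<close> is \<open>H = X + \<langle>e, A e\<rangle> Z\<close>. If it is positive definite, one
  congruence diagonalises \<open>H\<close> and \<open>Z\<close>, hence also \<open>X = H - \<langle>e, A e\<rangle> Z\<close>, which leads to the
  diagonal case.
\<close>

lemma positivity_transfer_definite:
  fixes I :: "'i set"
  assumes fin: "finite I"
    and X: "hermitian_on I X" and Y: "hermitian_on I Y" and Z: "hermitian_on I Z"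
    and pd: "positive_definite_on I (\<lambda>i j. 1 * X i j + a e e * Z i j)"
    and T: "\<And>u. 0 \<le> block_form I X g u u + block_form I Y p u u + block_form I Z a u u"
  shows "0 \<le> block_form I X g' x x + block_form I Y q x x + block_form I Z a' x x"
proof -
  define H where "H = (\<lambda>i j. 1 * X i j + a e e * Z i j)"
  have "cnj (a e e) = a e e" using e(3) by (simp add: complex_eq_iff)
  then have H: "hermitian_on I H"
    unfolding hermitian_on_def H_def
    by (simp add: hermitian_onD[OF X, symmetric] hermitian_onD[OF Z, symmetric])
  obtain F where diag: "\<forall>l\<in>I. \<forall>m\<in>I. l \<noteq> m \<longrightarrow>
        matrix_form I H (F l) (F m) = 0 \<and> matrix_form I Z (F l) (F m) = 0"
    and surj: "\<And>x :: 'i \<Rightarrow> 'k. \<exists>y. \<forall>i\<in>I. x i = (\<Sum>l\<in>I. F l i *\<^sub>C y l)"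
    using simultaneous_diagonalisation[OF fin H Z pd[folded H_def], where 'a='k] by blast
  have diagX: "matrix_form I X (F l) (F m) = 0" if "l \<in> I" "m \<in> I" "l \<noteq> m" for l m
  proof -
    have "matrix_form I H (F l) (F m) = matrix_form I X (F l) (F m) + a e e * matrix_form I Z (F l) (F m)"
      unfolding H_def block_form_lincomb by simp
    then show ?thesis using diag that by simp
  qed
  have diagZ: "matrix_form I Z (F l) (F m) = 0" if "l \<in> I" "m \<in> I" "l \<noteq> m" for l m
    using diag that by blast
  define \<xi> where "\<xi> l = Re (matrix_form I X (F l) (F l))" for l
  define \<zeta> where "\<zeta> l = Re (matrix_form I Z (F l) (F l))" for l
  define Y' where "Y' = (\<lambda>l m. matrix_form I Y (F l) (F m))"
  have real: "of_real (Re (matrix_form I M c c)) = matrix_form I M c c" if "hermitian_on I M" for M c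
    using matrix_form_commute[OF that, of c c]
    by (metis Reals_cnj_iff of_real_Re)
  have coords: "block_form I X f1 x x + block_form I Y f2 x x + block_form I Z f3 x x
      = (\<Sum>l\<in>I. of_real (\<xi> l) * f1 (y l) (y l) + of_real (\<zeta> l) * f3 (y l) (y l)) + block_form I Y' f2 y y"
    if f: "sesquilinear f1" "sesquilinear f2" "sesquilinear f3"
      and x: "\<And>i. i \<in> I \<Longrightarrow> x i = (\<Sum>l\<in>I. F l i *\<^sub>C y l)"
    for f1 f2 f3 :: "'z::complex_vector \<Rightarrow> 'z \<Rightarrow> complex" and x y
  proof -
    have "block_form I X f1 x x = (\<Sum>l\<in>I. of_real (\<xi> l) * f1 (y l) (y l))"
      unfolding \<xi>_def real[OF X]
      by (simp add: block_form_change_basis[OF f(1) x x] block_form_diagonal[OF fin diagX])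
    moreover have "block_form I Z f3 x x = (\<Sum>l\<in>I. of_real (\<zeta> l) * f3 (y l) (y l))"
      unfolding \<zeta>_def real[OF Z]
      by (simp add: block_form_change_basis[OF f(3) x x] block_form_diagonal[OF fin diagZ])
    moreover have "block_form I Y f2 x x = block_form I Y' f2 y y"
      unfolding Y'_def by (rule block_form_change_basis[OF f(2) x x])
    ultimately show ?thesis by (simp add: sum.distrib)
  qed
  obtain y where y: "\<And>i. i \<in> I \<Longrightarrow> x i = (\<Sum>l\<in>I. F l i *\<^sub>C y l)"
    using surj by blast
  have "0 \<le> (\<Sum>l\<in>I. of_real (\<xi> l) * g' (y l) (y l) + of_real (\<zeta> l) * a' (y l) (y l))
      + block_form I Y' q y y"
  proof (rule positivity_transfer_diagonal[OF fin])
    show "hermitian_on I Y'"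
      unfolding hermitian_on_def Y'_def using matrix_form_commute[OF Y] by blast
    show "0 \<le> (\<Sum>l\<in>I. of_real (\<xi> l) * g (u l) (u l) + of_real (\<zeta> l) * a (u l) (u l))
        + block_form I Y' p u u" for u
      using T[of "\<lambda>i. \<Sum>l\<in>I. F l i *\<^sub>C u l"]
      by (subst (asm) coords[OF sesq(1) sesq_p sesq(2), of _ u]) simp_all
  qed
  then show ?thesis
    by (subst coords[OF sesq'(1,3,2) y])
qed

text \<open>
  In general the compression to \<open>e\<close> is only semidefinite. Adding \<open>\<epsilon>\<close> times the identity to
  \<open>T\<close> makes it definite, and in the conclusion \<open>\<epsilon>\<close> tends to zero.
\<close>

lemma positivity_transfer:
  fixes I :: "'i set"
  assumes fin: "finite I"
    and X: "hermitian_on I X" and Y: "hermitian_on I Y" and Z: "hermitian_on I Z"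
    and T: "\<And>u. 0 \<le> block_form I X g u u + block_form I Y p u u + block_form I Z a u u"
  shows "0 \<le> block_form I X g' x x + block_form I Y q x x + block_form I Z a' x x"
proof -
  define K where "K = (\<lambda>i j :: 'i. if i = j then 1 else 0 :: complex)"
  define s where "s = (\<Sum>i\<in>I. g' (x i) (x i))"
  define E where "E = block_form I X g' x x + block_form I Y q x x + block_form I Z a' x x"
  have Kform: "block_form I K f z z = (\<Sum>i\<in>I. f (z i) (z i))"
    for f :: "'z \<Rightarrow> 'z \<Rightarrow> complex" and z
    by (subst block_form_diagonal[OF fin]) (auto simp: K_def)
  have "0 \<le> of_real \<epsilon> * s + E" if \<epsilon>: "0 < \<epsilon>" for \<epsilon> :: real
  proof -
    define X' where "X' = (\<lambda>i j. 1 * X i j + of_real \<epsilon> * K i j)"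
    have X'form: "block_form I X' f z z = block_form I X f z z + of_real \<epsilon> * (\<Sum>i\<in>I. f (z i) (z i))"
      for f :: "'z \<Rightarrow> 'z \<Rightarrow> complex" and z
      unfolding X'_def block_form_lincomb Kform by simp
    have "0 \<le> block_form I X' g' x x + block_form I Y q x x + block_form I Z a' x x"
    proof (rule positivity_transfer_definite[OF fin _ Y Z])
      show "hermitian_on I X'"
        unfolding hermitian_on_def X'_def by (auto simp: K_def hermitian_onD[OF X, symmetric])
      show "positive_definite_on I (\<lambda>i j. 1 * X' i j + a e e * Z i j)"
        unfolding positive_definite_on_def block_form_lincomb
      proof (intro allI impI)
        fix c :: "'i \<Rightarrow> complex"
        assume "\<exists>i\<in>I. c i \<noteq> 0"
        then have "0 < (\<Sum>i\<in>I. (cmod (c i))\<^sup>2)" using fin by (auto intro: sum_pos2)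
        moreover have "(\<Sum>i\<in>I. cinner (c i) (c i)) = of_real (\<Sum>i\<in>I. (cmod (c i))\<^sup>2)"
          using matrix_form_identity[OF fin, of c] Kform[of cinner c] by (simp add: K_def)
        moreover have "block_form I M f (\<lambda>i. c i *\<^sub>C e) (\<lambda>i. c i *\<^sub>C e) = f e e * matrix_form I M c c"
          if "sesquilinear f" for M f
          by (simp add: block_form_def sesquilinearD[OF that] cinner_complex_def sum_distrib_left
              algebra_simps)
        from this[OF sesq(1)] this[OF sesq(2)] this[OF sesq_p]
        have "0 \<le> matrix_form I X c c + a e e * matrix_form I Z c c"
          using T[of "\<lambda>i. c i *\<^sub>C e"] e by simp
        moreover have "1 * matrix_form I X' c c + a e e * matrix_form I Z c c
            = (matrix_form I X c c + a e e * matrix_form I Z c c)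
              + of_real \<epsilon> * (\<Sum>i\<in>I. cinner (c i) (c i))"
          by (simp add: X'form)
        ultimately show "0 < Re (1 * matrix_form I X' c c + a e e * matrix_form I Z c c)"
          using \<epsilon> unfolding complex_nonneg_iff
          by (simp only: plus_complex.sel Re_complex_of_real flip: of_real_mult) (simp add: add_nonneg_pos)
      qed
      show "0 \<le> block_form I X' g u u + block_form I Y p u u + block_form I Z a u u" for u
      proof -
        have "0 \<le> of_real \<epsilon> * (\<Sum>i\<in>I. g (u i) (u i))"
          using \<epsilon> by (intro mult_nonneg_nonneg sum_nonneg g_nonneg) (simp add: complex_nonneg_iff)
        from add_nonneg_nonneg[OF this T[of u]] show ?thesis
          by (simp add: X'form algebra_simps)
      qed
    qed
    then show ?thesis by (simp add: X'form E_def s_def algebra_simps)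
  qed
  then have *: "0 \<le> \<epsilon> * Re s + Re E" "\<epsilon> * Im s + Im E = 0" if "0 < \<epsilon>" for \<epsilon>
    using that by (simp_all add: complex_nonneg_iff)
  have "- Re s * \<epsilon> \<le> Re E" if "0 < \<epsilon>" for \<epsilon>
    using *(1)[OF that] by (simp add: algebra_simps)
  then have "0 \<le> Re E" by (rule nonneg_of_eps)
  moreover have "Im E = 0" using *(2)[of 1] *(2)[of 2] by simp
  ultimately show ?thesis by (simp add: complex_nonneg_iff flip: E_def)
qed

end

section \<open>Matrices of rank one and three-dimensional operator systems\<close>

lemma scaleC_matrix_nth: "(c *\<^sub>C A) $ i $ j = c * A $ i $ j" for A :: "complex ^ 'n ^ 'm"
  by (simp add: scaleC_vec_def scaleC_complex_def)

lemma scaleC_cvec_nth: "(c *\<^sub>C v) $ i = c * v $ i" for v :: "complex ^ 'n"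
  by (simp add: scaleC_vec_def scaleC_complex_def)

lemma scaleC_matrix_vector_mult: "(c *\<^sub>C A) *v x = c *\<^sub>C (A *v x)" for A :: "complex ^ 'n ^ 'm"
  by (simp add: vec_eq_iff matrix_vector_mult_def scaleC_matrix_nth scaleC_cvec_nth
      sum_distrib_left mult.assoc)

lemma matrix_vector_mult_scaleC: "A *v (c *\<^sub>C x) = c *\<^sub>C (A *v x)" for A :: "complex ^ 'n ^ 'm"
  by (simp add: vec_eq_iff matrix_vector_mult_def scaleC_cvec_nth sum_distrib_left mult.left_commute)

definition outer :: "complex ^ 'n \<Rightarrow> complex ^ 'n ^ 'n" where
  "outer v = (\<chi> i j. v $ i * cnj (v $ j))"

lemma outer_mult_vec: "outer v *v u = cinner v u *\<^sub>C v"
  by (simp add: vec_eq_iff outer_def matrix_vector_mult_def scaleC_cvec_nth cinner_vec_def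
      cinner_complex_def sum_distrib_right sum_distrib_left algebra_simps)

lemma cinner_outer: "cinner u (outer v *v w) = cnj (cinner v u) * cinner v w"
  by (simp add: outer_mult_vec cinner_scaleC_right mult.commute flip: cinner_commute[of u v])

lemma cadjoint_simps:
  "cadjoint (A + B) = cadjoint A + cadjoint B"
  "cadjoint (c *\<^sub>C A) = cnj c *\<^sub>C cadjoint A"
  "cadjoint (mat 1 :: complex ^ 'n ^ 'n) = mat 1"
  "cadjoint (outer v) = outer v"
  by (simp_all add: vec_eq_iff cadjoint_def scaleC_matrix_nth mat_def outer_def mult.commute)

lemma rank_one_product:
  fixes A :: "complex ^ 'n ^ 'm"
  assumes "rank A = 1"
  obtains a b where "A = (\<chi> i j. a $ i * b $ j)" "a \<noteq> 0" "b \<noteq> 0"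
proof -
  obtain B where B: "B \<subseteq> rows A" "vec.independent B" "rows A \<subseteq> vec.span B" "card B = 1"
    using vec.basis_exists[of "rows A"] assms by (metis row_rank_def_gen)
  then obtain b where Bb: "B = {b}" by (auto simp: card_1_singleton_iff)
  have b: "b \<noteq> 0" using B(2) Bb by (simp add: vec.dependent_single)
  have "\<exists>k. row i A = k *s b" for i
    using B(3) Bb by (auto simp: rows_def vec.span_singleton)
  then obtain k where k: "\<And>i. row i A = k i *s b" by metis
  have A: "A = (\<chi> i j. (\<chi> i. k i) $ i * b $ j)"
    using k by (simp add: vec_eq_iff row_def)
  moreover have "(\<chi> i. k i) \<noteq> 0"
  proof
    assume "(\<chi> i. k i) = 0"
    then have "row i A = 0" for i by (simp add: k vec_eq_iff)
    then show False using B(1) Bb b by (auto simp: rows_def)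
  qed
  ultimately show thesis using that b by blast
qed

lemma vec_cmod_sum_pos: "v \<noteq> 0 \<Longrightarrow> 0 < (\<Sum>i\<in>UNIV. (cmod (v $ i))\<^sup>2)" for v :: "complex ^ 'n"
  by (auto simp: vec_eq_iff intro: sum_pos2)

text \<open>
  Let \<open>A = a b\<^sup>T\<close>. Then \<open>A A\<^sup>*\<close> is a nonzero multiple of the projection onto the line of \<open>a\<close>, and
  \<open>A\<^sup>* A\<close> is one of the projection onto the line of the entrywise conjugate of \<open>b\<close>. If they
  agree, the two lines are the same.
\<close>

lemma normal_rank_one:
  fixes A :: "complex ^ 'n ^ 'n"
  assumes "rank A = 1" "normal_matrix A"
  obtains c v where "c \<noteq> 0" "v \<noteq> 0" "A = c *\<^sub>C outer v"
proof -
  obtain a b where A: "A = (\<chi> i j. a $ i * b $ j)" and a: "a \<noteq> 0" and b: "b \<noteq> 0"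
    using rank_one_product[OF assms(1)] .
  define \<alpha> where "\<alpha> = complex_of_real (\<Sum>i\<in>UNIV. (cmod (a $ i))\<^sup>2)"
  define \<beta> where "\<beta> = complex_of_real (\<Sum>i\<in>UNIV. (cmod (b $ i))\<^sup>2)"
  have "\<alpha> \<noteq> 0" unfolding \<alpha>_def of_real_eq_0_iff using vec_cmod_sum_pos[OF a] by linarith
  have "\<beta> \<noteq> 0" unfolding \<beta>_def of_real_eq_0_iff using vec_cmod_sum_pos[OF b] by linarith
  have *: "a $ i * cnj (a $ j) * \<beta> = cnj (b $ i) * b $ j * \<alpha>" for i j
  proof -
    have "(A ** cadjoint A) $ i $ j = (cadjoint A ** A) $ i $ j"
      using assms(2) by (simp add: normal_matrix_def)
    moreover have "(A ** cadjoint A) $ i $ j = a $ i * cnj (a $ j) * \<beta>"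
      unfolding \<beta>_def of_real_sum complex_norm_square
      by (simp add: A matrix_matrix_mult_def cadjoint_def sum_distrib_left algebra_simps)
    moreover have "(cadjoint A ** A) $ i $ j = cnj (b $ i) * b $ j * \<alpha>"
      unfolding \<alpha>_def of_real_sum complex_norm_square
      by (simp add: A matrix_matrix_mult_def cadjoint_def sum_distrib_left algebra_simps)
    ultimately show ?thesis by simp
  qed
  obtain k where k: "b $ k \<noteq> 0" using b by (auto simp: vec_eq_iff)
  define t where "t = cnj (cnj (a $ k) * \<beta> / (b $ k * \<alpha>))"
  have bt: "b $ j = t * cnj (a $ j)" for j
  proof -
    have "cnj (b $ j) = cnj (a $ k) * \<beta> / (b $ k * \<alpha>) * a $ j"
      using *[of j k] k \<open>\<alpha> \<noteq> 0\<close> by (simp add: field_simps)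
    then have "cnj (cnj (b $ j)) = t * cnj (a $ j)"
      by (simp add: t_def)
    then show ?thesis by simp
  qed
  have "t \<noteq> 0" using k bt[of k] by auto
  moreover have "A = t *\<^sub>C outer a"
    by (simp add: A vec_eq_iff scaleC_matrix_nth outer_def bt)
  ultimately show thesis using that a by blast
qed

lemma exists_unit_orthogonal:
  fixes v :: "complex ^ 'n"
  assumes "i \<noteq> (j :: 'n)"
  obtains e where "cinner v e = 0" "cinner e e = 1"
proof -
  define w :: "complex ^ 'n" where "w = (if v $ i = 0 then axis i 1
    else (\<chi> k. if k = i then cnj (v $ j) else if k = j then - cnj (v $ i) else 0))"
  have vw: "cinner v w = 0"
  proof (cases "v $ i = 0")
    case True
    then show ?thesis
      by (simp add: w_def cinner_vec_def cinner_complex_def axis_def if_distrib cong: if_cong)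
  next
    case False
    have "cinner v w = (\<Sum>k\<in>UNIV. (if k = i then cnj (v $ i) * cnj (v $ j) else 0)
        + (if k = j then - cnj (v $ i) * cnj (v $ j) else 0))"
      unfolding cinner_vec_def using False assms
      by (intro sum.cong) (auto simp: w_def cinner_complex_def)
    then show ?thesis by (simp add: sum.distrib)
  qed
  have "w \<noteq> 0"
    using assms by (auto simp: w_def vec_eq_iff axis_def dest: spec[of _ j] spec[of _ i])
  define r where "r = Re (cinner w w)"
  have ww: "cinner w w = of_real r"
    using cinner_ge_zero[of w] by (simp add: r_def less_eq_complex_def complex_eq_iff)
  have r: "0 < r"
    using cinner_ge_zero[of w] cinner_eq_zero_iff[of w] \<open>w \<noteq> 0\<close> ww by (auto simp: less_eq_complex_def)
  define e where "e = complex_of_real (1 / sqrt r) *\<^sub>C w"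
  have "cinner v e = 0" by (simp add: e_def cinner_scaleC_right vw)
  moreover have "cinner e e = 1"
  proof -
    have "cinner e w = complex_of_real (1 / sqrt r) * of_real r"
      by (subst cinner_commute) (simp add: e_def cinner_scaleC_right ww)
    note ew = this
    have "cinner e e = complex_of_real (1 / sqrt r) * cinner e w"
      by (subst (2) e_def) (rule cinner_scaleC_right)
    also have "\<dots> = of_real (1 / sqrt r * (1 / sqrt r * r))"
      by (simp only: ew of_real_mult)
    also have "1 / sqrt r * (1 / sqrt r * r) = 1" using r by (simp add: field_simps)
    finally show ?thesis by simp
  qed
  ultimately show thesis using that by blast
qed

lemma dim_le_1_if_trivial_index:
  fixes S :: "(complex ^ 'n ^ 'n) set"
  assumes "\<And>i j :: 'n. i = j"
  shows "complex_vector.dim S \<le> 1"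
proof -
  have "A \<in> complex_vector.span {mat 1}" for A :: "complex ^ 'n ^ 'n"
  proof -
    define i0 :: 'n where "i0 = undefined"
    have "A = (A $ i0 $ i0) *\<^sub>C mat 1"
      using assms by (simp add: vec_eq_iff scaleC_matrix_nth mat_def) metis
    then show ?thesis
      by (metis complex_vector.span_base complex_vector.span_scale singletonI)
  qed
  then show ?thesis
    using complex_vector.dim_le_card[of S "{mat 1}"] by auto
qed

text \<open>
  Write \<open>C = R + \<i> J\<close> with self-adjoint \<open>R\<close> and \<open>J\<close> in \<open>S\<close>. If \<open>R\<close> or \<open>J\<close> has a nonzero
  \<open>C\<close>-coefficient, it can replace \<open>C\<close>; otherwise \<open>C\<close> is a combination of \<open>Q\<close> and \<open>P\<close>, and
  \<open>A = 0\<close> does.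
\<close>

lemma self_adjoint_generator:
  fixes S :: "(complex ^ 'n ^ 'n) set"
  assumes S: "operator_system S" and C: "C \<in> S"
    and gen: "\<And>s. s \<in> S \<Longrightarrow> \<exists>x y z. s = x *\<^sub>C Q + y *\<^sub>C P + z *\<^sub>C C"
    and QP: "Q \<in> S" "P \<in> S"
  obtains A where "A \<in> S" "cadjoint A = A"
    "\<And>s. s \<in> S \<Longrightarrow> \<exists>x y z. s = x *\<^sub>C Q + y *\<^sub>C P + z *\<^sub>C A"
proof -
  have sub: "complex_vector.subspace S" and adj: "\<And>A. A \<in> S \<Longrightarrow> cadjoint A \<in> S"
    using S by (auto simp: operator_system_def)
  note main = that
  have suff: thesis if A: "A \<in> S" "cadjoint A = A" and CA: "C = x *\<^sub>C Q + y *\<^sub>C P + z *\<^sub>C A" for A x y z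
  proof (rule main[OF A])
    fix s
    assume "s \<in> S"
    then obtain x' y' z' where s: "s = x' *\<^sub>C Q + y' *\<^sub>C P + z' *\<^sub>C C" using gen by blast
    have "s = (x' + z' * x) *\<^sub>C Q + (y' + z' * y) *\<^sub>C P + (z' * z) *\<^sub>C A"
      unfolding s CA by (simp add: vec_eq_iff scaleC_matrix_nth algebra_simps)
    then show "\<exists>x y z. s = x *\<^sub>C Q + y *\<^sub>C P + z *\<^sub>C A" by blast
  qed
  define R where "R = (1/2) *\<^sub>C (C + cadjoint C)"
  define J where "J = (1/(2*\<i>)) *\<^sub>C (C + (-1) *\<^sub>C cadjoint C)"
  note add = complex_vector.subspace_add[OF sub] and scale = complex_vector.subspace_scale[OF sub]
  have mem: "R \<in> S" "J \<in> S"
    unfolding R_def J_def by (rule scale add adj C)+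
  have RJ: "cadjoint R = R" "cadjoint J = J"
    by (simp_all add: R_def J_def vec_eq_iff cadjoint_def scaleC_matrix_nth field_simps)
  have CRJ: "C = R + \<i> *\<^sub>C J"
    by (simp add: R_def J_def vec_eq_iff scaleC_matrix_nth field_simps)
  obtain x1 y1 z1 where R: "R = x1 *\<^sub>C Q + y1 *\<^sub>C P + z1 *\<^sub>C C" using gen[OF mem(1)] by blast
  obtain x2 y2 z2 where J: "J = x2 *\<^sub>C Q + y2 *\<^sub>C P + z2 *\<^sub>C C" using gen[OF mem(2)] by blast
  consider "z1 \<noteq> 0" | "z2 \<noteq> 0" | "z1 = 0" "z2 = 0" by blast
  then show thesis
  proof cases
    case 1
    then have "C = (- x1 / z1) *\<^sub>C Q + (- y1 / z1) *\<^sub>C P + (1 / z1) *\<^sub>C R"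
      unfolding R by (simp add: vec_eq_iff scaleC_matrix_nth field_simps)
    then show thesis by (rule suff[OF mem(1) RJ(1)])
  next
    case 2
    then have "C = (- x2 / z2) *\<^sub>C Q + (- y2 / z2) *\<^sub>C P + (1 / z2) *\<^sub>C J"
      unfolding J by (simp add: vec_eq_iff scaleC_matrix_nth field_simps)
    then show thesis by (rule suff[OF mem(2) RJ(2)])
  next
    case 3
    have "C = (x1 + \<i> * x2) *\<^sub>C Q + (y1 + \<i> * y2) *\<^sub>C P + 0 *\<^sub>C 0"
      using CRJ R J 3 by (simp add: vec_eq_iff scaleC_matrix_nth algebra_simps)
    moreover have "0 \<in> S" using sub by (rule complex_vector.subspace_0)
    moreover have "cadjoint 0 = (0 :: complex ^ 'n ^ 'n)" by (simp add: vec_eq_iff cadjoint_def)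
    ultimately show thesis using suff by blast
  qed
qed

lemma three_dimensional_span:
  fixes S :: "(complex ^ 'n ^ 'n) set"
  assumes "Q \<in> S" "P \<in> S" "complex_vector.dim S = 3"
    and "P \<noteq> 0" "\<And>k. Q \<noteq> k *\<^sub>C P"
  obtains C where "C \<in> S" "\<And>s. s \<in> S \<Longrightarrow> \<exists>x y z. s = x *\<^sub>C Q + y *\<^sub>C P + z *\<^sub>C C"
proof -
  have "complex_vector.independent {Q, P}"
    using assms(4,5)
    by (simp add: complex_vector.independent_insert complex_vector.span_singleton) blast
  then obtain B where B: "{Q, P} \<subseteq> B" "B \<subseteq> S" "complex_vector.independent B"
      "S \<subseteq> complex_vector.span B"
    using complex_vector.maximal_independent_subset_extend[of "{Q, P}" S] assms(1,2) by blast
  have card: "card B = 3"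
    using complex_vector.basis_card_eq_dim[OF B(2,4,3)] assms(3) by simp
  then have "finite B" using card.infinite by fastforce
  have "Q \<noteq> P" using assms(5)[of 1] by (simp add: scaleC_one)
  then have "card (B - {Q, P}) = 1"
    using B(1) card \<open>finite B\<close> by (subst card_Diff_subset) auto
  then obtain C where "B - {Q, P} = {C}" by (auto simp: card_1_singleton_iff)
  then have BC: "B = {Q, P, C}" using B(1) by blast
  show thesis
  proof (rule that)
    show "C \<in> S" using B(2) BC by blast
    fix s
    assume "s \<in> S"
    then have "s \<in> complex_vector.span {Q, P, C}" using B(4) BC by blast
    then obtain x y z where "s - x *\<^sub>C Q - y *\<^sub>C P = z *\<^sub>C C"
      by (auto simp: complex_vector.span_breakdown_eq[of _ Q] complex_vector.span_breakdown_eq[of _ P]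
          complex_vector.span_singleton)
    then have "s = x *\<^sub>C Q + y *\<^sub>C P + z *\<^sub>C C" by (simp add: algebra_simps)
    then show "\<exists>x y z. s = x *\<^sub>C Q + y *\<^sub>C P + z *\<^sub>C C" by blast
  qed
qed

lemma sesquilinear_matrix: "sesquilinear (\<lambda>u w. cinner u (A *v w))"
  for A :: "complex ^ 'n ^ 'n"
  by (simp add: sesquilinear_def cinner_add_left cinner_add_right cinner_scaleC_left
      cinner_scaleC_right matrix_vector_right_distrib matrix_vector_mult_scaleC)

lemma cinner_0: "cinner x 0 = 0" "cinner 0 x = 0"
  using sesquilinear_0[OF sesquilinear_cinner] by blast+

lemma cinner_sum_right: "cinner x (\<Sum>i\<in>I. y i) = (\<Sum>i\<in>I. cinner x (y i))"
  by (rule sesquilinear_sum(2)[OF sesquilinear_cinner])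

lemma cinner_axis_matrix: "cinner (axis p 1) (A *v axis q 1) = A $ p $ q"
  for A :: "complex ^ 'n ^ 'n"
  by (simp add: cinner_vec_def cinner_complex_def axis_def matrix_vector_mult_def if_distrib
      if_distribR cong: if_cong)

text \<open>
  The expression is the value at \<open>x + t y\<close> of a sesquilinear form \<open>D\<close> with \<open>b = D(x, y)\<close> and
  \<open>c = D(y, x)\<close>; real and imaginary parts are compared at \<open>t = 0, \<plusminus>1, \<plusminus>\<i>\<close>.
\<close>

lemma polarisation_hermitian:
  fixes a b c d :: complex
  assumes "\<And>t. Im (a + t * b + cnj t * c + cnj t * t * d) = 0"
  shows "c = cnj b"
  using assms[of 0] assms[of 1] assms[of "-1"] assms[of \<i>] assms[of "-\<i>"]
  by (simp add: complex_eq_iff)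

text \<open>
  A complex quadratic form with real values is Hermitian. Polarisation is applied to families
  supported in a single index.
\<close>

lemma positive_block_hermitian:
  fixes T :: "nat \<Rightarrow> nat \<Rightarrow> complex ^ 'n ^ 'n"
  assumes pos: "positive_block_operator k (\<lambda>i j. (*v) (T i j))" and ij: "i < k" "j < k"
  shows "T j i = cadjoint (T i j)"
proof -
  define D where "D x y = (\<Sum>i<k. \<Sum>j<k. cinner (x i) (T i j *v y j))" for x y
  have D_pos: "0 \<le> D x x" for x
    using pos by (simp add: positive_block_operator_def D_def cinner_sum_right)
  note sesq = sesquilinearD[OF sesquilinear_matrix]
  have "D y x = cnj (D x y)" for x y
  proof (rule polarisation_hermitian)
    fix t
    have "D (\<lambda>i. x i + t *\<^sub>C y i) (\<lambda>i. x i + t *\<^sub>C y i)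
        = D x x + t * D x y + cnj t * D y x + cnj t * t * D y y"
      unfolding D_def
      by (simp only: sesq sum.distrib sum_distrib_left[symmetric])
        (simp add: sesq sum.distrib sum_distrib_left algebra_simps)
    then show "Im (D x x + t * D x y + cnj t * D y x + cnj t * t * D y y) = 0"
      using D_pos[of "\<lambda>i. x i + t *\<^sub>C y i"] by (simp add: less_eq_complex_def)
  qed
  moreover have "D (\<lambda>m. if m = i then u else 0) (\<lambda>m. if m = j then w else 0) = cinner u (T i j *v w)"
    if "i < k" "j < k" for i j u w
  proof -
    have "D (\<lambda>m. if m = i then u else 0) (\<lambda>m. if m = j then w else 0)
        = (\<Sum>i'<k. \<Sum>j'<k. if j' = j then (if i' = i then cinner u (T i j *v w) else 0) else 0)"
      unfolding D_def by (intro sum.cong refl) (auto simp: cinner_0)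
    then show ?thesis using that by simp
  qed
  ultimately have "cinner w (T j i *v u) = cnj (cinner u (T i j *v w))" for u w
    using ij by metis
  then have "T j i $ p $ q = cnj (T i j $ q $ p)" for p q
    using cinner_axis_matrix by metis
  then show ?thesis by (simp add: vec_eq_iff cadjoint_def)
qed

section \<open>Complete positivity\<close>

text \<open>
  The matrix \<open>P = v v\<^sup>*\<close> enters only through \<open>\<langle>u, P w\<rangle> = cnj \<langle>v, u\<rangle> \<cdot> \<langle>v, w\<rangle>\<close>, so \<open>\<phi>\<close> is the
  functional \<open>\<langle>v, \<cdot>\<rangle>\<close>.
\<close>

lemma rank_one_pencil_from_positive_map:
  fixes S :: "(complex ^ 'n ^ 'n) set" and \<Phi> :: "complex ^ 'n ^ 'n \<Rightarrow> 'k::chilbert_space \<Rightarrow> 'k"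
  assumes S: "operator_system S"
    and \<Phi>: "operator_linear_map S \<Phi>" "unital_map \<Phi>" "positive_map S \<Phi>"
    and P: "outer v \<in> S" and v: "v \<noteq> 0" and A: "A \<in> S" "cadjoint A = A"
    and e: "cinner v e = 0" "cinner e e = 1"
  shows "rank_one_pencil cinner (\<lambda>u w. cinner u (A *v w)) (cinner v) e
    cinner (\<lambda>x y. cinner x (\<Phi> A y)) (\<lambda>x y. cinner x (\<Phi> (outer v) y))"
  and "\<Phi> (x *\<^sub>C mat 1 + y *\<^sub>C outer v + z *\<^sub>C A) w
    = x *\<^sub>C w + y *\<^sub>C \<Phi> (outer v) w + z *\<^sub>C \<Phi> A w"
proof -
  have sub: "complex_vector.subspace S" and one: "mat 1 \<in> S"
    using S by (auto simp: operator_system_def)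
  note add = complex_vector.subspace_add[OF sub] and scale = complex_vector.subspace_scale[OF sub]
  have \<Phi>_add: "\<Phi> (B + C) w = \<Phi> B w + \<Phi> C w" if "B \<in> S" "C \<in> S" for B C w
    using \<Phi>(1) that by (simp add: operator_linear_map_def)
  have \<Phi>_scale: "\<Phi> (c *\<^sub>C B) w = c *\<^sub>C \<Phi> B w" if "B \<in> S" for B c w
    using \<Phi>(1) that by (simp add: operator_linear_map_def)
  have bdd: "\<Phi> B \<in> bounded_operators" if "B \<in> S" for B
    using \<Phi>(1) that by (simp add: operator_linear_map_def)
  have \<Phi>1: "\<Phi> (mat 1) w = w" for w
    using \<Phi>(2) by (simp add: unital_map_def)
  show pencil: "\<Phi> (x *\<^sub>C mat 1 + y *\<^sub>C outer v + z *\<^sub>C A) w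
      = x *\<^sub>C w + y *\<^sub>C \<Phi> (outer v) w + z *\<^sub>C \<Phi> A w" for x y z w
    by (simp add: \<Phi>_add \<Phi>_scale \<Phi>1 add scale one P A)
  have A_herm: "cinner w (A *v u) = cnj (cinner u (A *v w))" for u w
  proof -
    have "cnj (A $ i $ j) = A $ j $ i" for i j
      using A(2) by (simp add: vec_eq_iff cadjoint_def)
    then have "cnj (cinner u (A *v w)) = (\<Sum>i\<in>UNIV. \<Sum>j\<in>UNIV. u $ i * (A $ j $ i * cnj (w $ j)))"
      by (simp add: cinner_vec_def cinner_complex_def matrix_vector_mult_def sum_distrib_left)
    also have "\<dots> = (\<Sum>j\<in>UNIV. \<Sum>i\<in>UNIV. u $ i * (A $ j $ i * cnj (w $ j)))"
      by (rule sum.swap)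
    also have "\<dots> = cinner w (A *v u)"
      by (simp add: cinner_vec_def cinner_complex_def matrix_vector_mult_def sum_distrib_left
          algebra_simps)
    finally show ?thesis by simp
  qed
  show "rank_one_pencil cinner (\<lambda>u w. cinner u (A *v w)) (cinner v) e
    cinner (\<lambda>x y. cinner x (\<Phi> A y)) (\<lambda>x y. cinner x (\<Phi> (outer v) y))"
  proof
    show "\<exists>u. cinner v u = 1"
      using v by (intro exI[of _ "(1 / cinner v v) *\<^sub>C v"])
        (simp add: cinner_scaleC_right cinner_eq_zero_iff)
    have "cnj (cinner e (A *v e)) = cinner e (A *v e)"
      using A_herm[of e e] by simp
    then show "Im (cinner e (A *v e)) = 0"
      by (simp add: complex_eq_iff)
  next
    fix \<xi> \<eta> \<zeta> :: real and x :: 'k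
    assume *: "\<And>u. 0 \<le> complex_of_real \<xi> * cinner u u + complex_of_real \<eta> * (cnj (cinner v u) * cinner v u)
      + complex_of_real \<zeta> * cinner u (A *v u)"
    define B where "B = of_real \<xi> *\<^sub>C mat 1 + of_real \<eta> *\<^sub>C outer v + of_real \<zeta> *\<^sub>C A"
    have "B \<in> S" unfolding B_def by (intro add scale one P A)
    moreover have "positive_operator ((*v) B)"
      using * by (simp add: positive_operator_def B_def matrix_vector_mult_add_rdistrib
          scaleC_matrix_vector_mult cinner_add_right cinner_scaleC_right cinner_outer)
    ultimately have "positive_operator (\<Phi> B)"
      using \<Phi>(3) by (simp add: positive_map_def)
    then have "0 \<le> cinner x (\<Phi> B x)" by (simp add: positive_operator_def)
    then show "0 \<le> of_real \<xi> * cinner x x + of_real \<eta> * cinner x (\<Phi> (outer v) x)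
        + of_real \<zeta> * cinner x (\<Phi> A x)"
      by (simp add: B_def pencil cinner_add_right cinner_scaleC_right)
  qed (simp_all add: sesquilinear_cinner sesquilinear_matrix sesquilinear_cinner_operator bdd P A e
      cinner_scaleC_right cinner_add_right cinner_ge_zero)
qed

text \<open>
  The coefficients of the blocks of \<open>T\<close> over \<open>I\<close>, \<open>P\<close>, \<open>A\<close> are made Hermitian by averaging with
  the adjoint, which does not change \<open>T\<close>. Then \<open>T\<close> and its image under \<open>\<Phi>\<close> have the shape
  required for the transfer of positivity.
\<close>

lemma positive_imp_completely_positive:
  fixes S :: "(complex ^ 'n ^ 'n) set" and \<Phi> :: "complex ^ 'n ^ 'n \<Rightarrow> 'k::chilbert_space \<Rightarrow> 'k"
  assumes S: "operator_system S"
    and \<Phi>: "operator_linear_map S \<Phi>" "unital_map \<Phi>" "positive_map S \<Phi>"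
    and P: "outer v \<in> S" and v: "v \<noteq> 0" and A: "A \<in> S" "cadjoint A = A"
    and e: "cinner v e = 0" "cinner e e = 1"
    and gen: "\<And>s. s \<in> S \<Longrightarrow> \<exists>x y z. s = x *\<^sub>C mat 1 + y *\<^sub>C outer v + z *\<^sub>C A"
  shows "completely_positive_map S \<Phi>"
  unfolding completely_positive_map_def
proof (intro allI impI)
  fix k and T :: "nat \<Rightarrow> nat \<Rightarrow> complex ^ 'n ^ 'n"
  assume TS: "\<forall>i<k. \<forall>j<k. T i j \<in> S"
    and Tpos: "positive_block_operator k (\<lambda>i j. (*v) (T i j))"
  interpret rank_one_pencil cinner "\<lambda>u w. cinner u (A *v w)" "cinner v" e
    cinner "\<lambda>x y. cinner x (\<Phi> A y)" "\<lambda>x y. cinner x (\<Phi> (outer v) y)"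
    by (rule rank_one_pencil_from_positive_map(1)[OF assms(1-10)])
  note \<Phi>_pencil = rank_one_pencil_from_positive_map(2)[OF assms(1-10)]
  have "\<forall>i j. \<exists>x y z. i < k \<longrightarrow> j < k \<longrightarrow> T i j = x *\<^sub>C mat 1 + y *\<^sub>C outer v + z *\<^sub>C A"
    using gen TS by blast
  then obtain X0 Y0 Z0 where T0: "\<And>i j. i < k \<Longrightarrow> j < k \<Longrightarrow>
      T i j = X0 i j *\<^sub>C mat 1 + Y0 i j *\<^sub>C outer v + Z0 i j *\<^sub>C A"
    by metis
  define h :: "(nat \<Rightarrow> nat \<Rightarrow> complex) \<Rightarrow> nat \<Rightarrow> nat \<Rightarrow> complex"
    where "h M = (\<lambda>i j. (M i j + cnj (M j i)) / 2)" for M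
  have h: "hermitian_on {..<k} (h M)" for M
    by (simp add: hermitian_on_def h_def add.commute)
  have T: "T i j = h X0 i j *\<^sub>C mat 1 + h Y0 i j *\<^sub>C outer v + h Z0 i j *\<^sub>C A"
    if ij: "i < k" "j < k" for i j
  proof -
    have "T i j = cadjoint (T j i)"
      by (rule positive_block_hermitian[OF Tpos ij(2,1)])
    also have "\<dots> = cnj (X0 j i) *\<^sub>C mat 1 + cnj (Y0 j i) *\<^sub>C outer v + cnj (Z0 j i) *\<^sub>C A"
      by (simp add: T0[OF ij(2,1)] cadjoint_simps A(2))
    finally have adj: "T i j = \<dots>" .
    have "T i j = (1/2) *\<^sub>C T i j + (1/2) *\<^sub>C T i j"
      by (simp add: vec_eq_iff scaleC_matrix_nth)
    also have "\<dots> = (1/2) *\<^sub>C (X0 i j *\<^sub>C mat 1 + Y0 i j *\<^sub>C outer v + Z0 i j *\<^sub>C A)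
        + (1/2) *\<^sub>C (cnj (X0 j i) *\<^sub>C mat 1 + cnj (Y0 j i) *\<^sub>C outer v + cnj (Z0 j i) *\<^sub>C A)"
      by (simp only: T0[OF ij, symmetric] adj[symmetric])
    also have "\<dots> = h X0 i j *\<^sub>C mat 1 + h Y0 i j *\<^sub>C outer v + h Z0 i j *\<^sub>C A"
      by (simp add: vec_eq_iff scaleC_matrix_nth h_def add_divide_distrib distrib_left distrib_right)
    finally show ?thesis .
  qed
  have "0 \<le> block_form {..<k} (h X0) cinner u u + block_form {..<k} (h Y0) p u u
      + block_form {..<k} (h Z0) (\<lambda>u w. cinner u (A *v w)) u u" for u
  proof -
    have "0 \<le> (\<Sum>i<k. \<Sum>j<k. cinner (u i) (T i j *v u j))"
      using Tpos by (simp add: positive_block_operator_def cinner_sum_right)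
    also have "\<dots> = (\<Sum>i<k. \<Sum>j<k. h X0 i j * cinner (u i) (u j) + h Y0 i j * p (u i) (u j)
        + h Z0 i j * cinner (u i) (A *v u j))"
      by (intro sum.cong refl) (simp add: T matrix_vector_mult_add_rdistrib
          scaleC_matrix_vector_mult cinner_add_right cinner_scaleC_right cinner_outer)
    finally show ?thesis by (simp add: block_form_def sum.distrib)
  qed
  note main = positivity_transfer[OF _ h h h this]
  show "positive_block_operator k (\<lambda>i j. \<Phi> (T i j))"
    unfolding positive_block_operator_def
  proof
    fix x :: "nat \<Rightarrow> 'k"
    have "0 \<le> block_form {..<k} (h X0) cinner x x
        + block_form {..<k} (h Y0) (\<lambda>x y. cinner x (\<Phi> (outer v) y)) x x
        + block_form {..<k} (h Z0) (\<lambda>x y. cinner x (\<Phi> A y)) x x"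
      by (rule main) simp
    also have "\<dots> = (\<Sum>i<k. \<Sum>j<k. cinner (x i) (\<Phi> (T i j) (x j)))"
      unfolding block_form_def sum.distrib[symmetric]
      by (intro sum.cong refl) (simp add: T \<Phi>_pencil cinner_add_right cinner_scaleC_right)
    finally show "0 \<le> (\<Sum>i<k. cinner (x i) (\<Sum>j<k. \<Phi> (T i j) (x j)))"
      by (simp add: cinner_sum_right)
  qed
qed

text \<open>
  It remains to bring \<open>S\<close> into the form above. A matrix algebra of size one has dimension at most
  one, so the size is at least two and a unit vector \<open>e\<close> orthogonal to \<open>v\<close> exists. It separates
  \<open>I\<close> from the multiples of \<open>P\<close>, so \<open>I\<close> and \<open>P\<close> extend to a basis of \<open>S\<close> by one matrix.
\<close>

theorem theorem3p5:
  fixes S :: "(complex ^ 'n ^ 'n) set"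
  assumes "operator_system S"
    and "complex_vector.dim S = 3"
    and "\<exists>A\<in>S. rank A = 1 \<and> normal_matrix A"
  shows "maximal_operator_system TYPE('k::chilbert_space) S"
proof -
  have sub: "complex_vector.subspace S" and one: "mat 1 \<in> S"
    using assms(1) by (auto simp: operator_system_def)
  obtain N where N: "N \<in> S" "rank N = 1" "normal_matrix N" using assms(3) by blast
  obtain c v where c: "c \<noteq> 0" and v: "v \<noteq> 0" and Nv: "N = c *\<^sub>C outer v"
    using normal_rank_one[OF N(2,3)] .
  have "outer v = (1 / c) *\<^sub>C N"
    using c by (simp add: Nv scaleC_scaleC scaleC_one)
  then have P: "outer v \<in> S"
    using complex_vector.subspace_scale[OF sub N(1)] by simp
  obtain i j :: 'n where "i \<noteq> j"
    using dim_le_1_if_trivial_index[of S] assms(2) by fastforce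
  then obtain e where e: "cinner v e = 0" "cinner e e = 1"
    using exists_unit_orthogonal by blast
  have "outer v \<noteq> 0"
  proof
    assume "outer v = 0"
    then have "outer v *v v = 0" by simp
    then show False
      using v by (simp add: outer_mult_vec complex_vector.scale_eq_0_iff cinner_eq_zero_iff)
  qed
  moreover have "mat 1 \<noteq> r *\<^sub>C outer v" for r
  proof
    assume "mat 1 = r *\<^sub>C outer v"
    then have "mat 1 *v e = r *\<^sub>C (outer v *v e)"
      by (simp only: scaleC_matrix_vector_mult)
    then have "e = 0" by (simp add: outer_mult_vec e)
    then show False using e(2) by (simp add: cinner_0)
  qed
  ultimately obtain C where C: "C \<in> S"
    and "\<And>s. s \<in> S \<Longrightarrow> \<exists>x y z. s = x *\<^sub>C mat 1 + y *\<^sub>C outer v + z *\<^sub>C C"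
    using three_dimensional_span[OF one P assms(2)] by blast
  then obtain A where "A \<in> S" "cadjoint A = A"
    and "\<And>s. s \<in> S \<Longrightarrow> \<exists>x y z. s = x *\<^sub>C mat 1 + y *\<^sub>C outer v + z *\<^sub>C A"
    using self_adjoint_generator[OF assms(1) C _ one P] by blast
  then show ?thesis
    unfolding maximal_operator_system_def
    using positive_imp_completely_positive[OF assms(1) _ _ _ P v _ _ e] assms(1) by blast
qed

end
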